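(* Consider the cyclically closed double-chain three-state generalized Potts model of length $L$ with zero external field, at temperature $T>0$, with real couplings $J_{\mu_1,\mu_2,\mu_3}$, and let $Z_L$ be its partition function and $\Theta$ its $9\times 9$ transfer-matrix, with entries denoted by $a,b,\dots,z,A$ (all as in the context). For $\varepsilon\in E=\{1,e^{2\pi \mathrm{i}/3},e^{4\pi \mathrm{i}/3}\}$ (the set of cubic roots of $1$; $\mathrm{i}$ is the imaginary unit) put $$\Theta_{\varepsilon}=\begin{pmatrix} a+g \varepsilon +k \varepsilon ^2 & d+h \varepsilon +i \varepsilon ^2 & e+f \varepsilon +j \varepsilon ^2 \\ l+o \varepsilon +s \varepsilon ^2 & b+p \varepsilon +q \varepsilon ^2 & m+n \varepsilon +r \varepsilon ^2 \\ t+w \varepsilon +A \varepsilon ^2 & u+x \varepsilon +y \varepsilon ^2 & c+v \varepsilon +z \varepsilon ^2 \end{pmatrix},$$ and let $\lambda_{\varepsilon,k}$, $k=1,2,3$, be the eigenvalues of $\Theta_\varepsilon$. Then: 1. The partition function can be presented as $$Z_{L} = \sum_{\varepsilon \in E}\sum_{k = 1}^{3}\lambda_{\varepsilon,k}^L .$$ 2. The principal (single largest real) eigenvalue of $\Theta_1$, determined from its secular (characteristic) equation, can be expressed in radicals (by Cardano's formula for the cubic equation), and it coincides with the principal eigenvalue of $\Theta$. 3. Furthermore, $\overline{\lambda}_{\varepsilon,k}=\lambda_{\overline{\varepsilon},k}$ for $k=1,2,3$.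
   Context: **Model.** The lattice is $\mathcal{L}_{2,L}=\{t_i^j : i=0,\dots,L-1,\ j=0,1\}$ with cyclic closure $t_L^j\equiv t_0^j$. A spin configuration is $\sigma=(\sigma_i^j)\in X^{\mathcal{L}_{2,L}}$ with $X=\{0,1,2\}$ (so the number of states is $3$), and $\sigma_L^j=\sigma_0^j$. The Hamiltonian is $$\mathcal{H}_L(\sigma)=\sum_{i=0}^{L-1}H(\sigma_i^0,\sigma_i^1;\sigma_{i+1}^0,\sigma_{i+1}^1),$$ where, with zero external field, $$H(\sigma_0,\sigma_1;\sigma_2,\sigma_3)=-\sum_{(\mu_1,\mu_2,\mu_3)\in X^3}J_{\mu_1,\mu_2,\mu_3}\,\delta_{\sigma_0,\ \mu_1+\sigma_1,\ \mu_2+\sigma_2,\ \mu_3+\sigma_3},$$ the $J_{\mu_1,\mu_2,\mu_3}$ are real constants, and $\delta_{a_1,\dots,a_s}=1$ if all $a_r$ are congruent modulo $3$, and $0$ otherwise. Hence $H(\sigma_0+1,\sigma_1+1;\sigma_2+1,\sigma_3+1)=H(\sigma_0,\sigma_1;\sigma_2,\sigma_3)$, with addition in $\mathbb{Z}_3$. The Boltzmann constant is $1$. The partition function is $$Z_L=\sum_{\sigma\in X^{\mathcal{L}_{2,L}}}e^{-\mathcal{H}_L(\sigma)/T}.$$ **Transfer-matrix.** $\Theta$ is the $9\times9$ matrix with entries $\langle\sigma_0,\sigma_1|\Theta|\sigma_2,\sigma_3\rangle=\exp[-H(\sigma_0,\sigma_1;\sigma_2,\sigma_3)/T]$. Rows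 are indexed by $(\sigma_0,\sigma_1)$ and columns by $(\sigma_2,\sigma_3)$, both in the order $(0,0),(1,0),(2,0),(0,1),(1,1),(2,1),(0,2),(1,2),(2,2)$. By the cyclic-shift invariance of $H$, it has the form $$\Theta=\begin{pmatrix} a& d& e& f& g& h& i& j& k\\ l& b& m& n& o& p& q& r& s\\ t& u& c& v& w& x& y& z& A\\ A& y& z& c& t& u& x& v& w\\ k& i& j& e& a& d& h& f& g\\ s& q& r& m& l& b& p& n& o\\ o& p& n& r& s& q& b& m& l\\ w& x& v& z& A& y& u& c& t\\ g& h& f& j& k& i& d& e& a \end{pmatrix},$$ where the letters $a,b,\dots,z,A$ are simply names for these positive real entries (in particular $i$ here is a matrix entry, not the imaginary unit).
   Formalization: Part 3 is proved up to a permutation of k for every numbering, and index by index for a suitable numbering except where ε=1 and the eigenvalue is not real, since Θ₁ may have non-real eigenvalues (e.g. circulant with first row 3,6,3); the length L is at least 1. *)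

theory Defs
  imports
    "HOL-Analysis.Analysis"
    "HOL-Number_Theory.Cong"
    "HOL-Combinatorics.Permutations"
    "Jordan_Normal_Form.Char_Poly"
begin

section \<open>The double-chain three-state generalized Potts model\<close>

definition X :: "nat set" where
  "X = {0, 1, 2}"

definition delta :: "nat list \<Rightarrow> real" where
  "delta as = (if \<forall>x\<in>set as. \<forall>y\<in>set as. [x = y] (mod 3) then 1 else 0)"

text \<open>
  Only the values of the couplings \<open>J\<close> on \<open>X\<close> matter. \<open>H J s0 s1 s2 s3\<close> is
  $H(\sigma_0,\sigma_1;\sigma_2,\sigma_3)$ at zero external field.
\<close>

definition H :: "(nat \<Rightarrow> nat \<Rightarrow> nat \<Rightarrow> real) \<Rightarrow> nat \<Rightarrow> nat \<Rightarrow> nat \<Rightarrow> nat \<Rightarrow> real" where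
  "H J s0 s1 s2 s3 =
     - (\<Sum>(m1, m2, m3) \<in> X \<times> X \<times> X. J m1 m2 m3 * delta [s0, m1 + s1, m2 + s2, m3 + s3])"

text \<open>The site $t_i^j$ is the pair \<open>(i, j)\<close>; the cyclic closure is the reduction modulo \<open>L\<close>.\<close>

definition hamiltonian ::
    "(nat \<Rightarrow> nat \<Rightarrow> nat \<Rightarrow> real) \<Rightarrow> nat \<Rightarrow> (nat \<times> nat \<Rightarrow> nat) \<Rightarrow> real" where
  "hamiltonian J L \<sigma> =
     (\<Sum>i<L. H J (\<sigma> (i, 0)) (\<sigma> (i, 1)) (\<sigma> (Suc i mod L, 0)) (\<sigma> (Suc i mod L, 1)))"

definition partition_function :: "(nat \<Rightarrow> nat \<Rightarrow> nat \<Rightarrow> real) \<Rightarrow> real \<Rightarrow> nat \<Rightarrow> real" where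
  "partition_function J T L =
     (\<Sum>\<sigma> \<in> ({..<L} \<times> {0, 1}) \<rightarrow>\<^sub>E X. exp (- hamiltonian J L \<sigma> / T))"


section \<open>The transfer-matrix\<close>

text \<open>
  The state \<open>(s, s')\<close> of a cell has index \<open>s + 3 * s'\<close>, which gives the order
  $(0,0),(1,0),(2,0),(0,1),\dots,(2,2)$ of rows and columns.
\<close>

definition Theta :: "(nat \<Rightarrow> nat \<Rightarrow> nat \<Rightarrow> real) \<Rightarrow> real \<Rightarrow> real mat" where
  "Theta J T = mat 9 9 (\<lambda>(r, c). exp (- H J (r mod 3) (r div 3) (c mod 3) (c div 3) / T))"

text \<open>
  The letters name the entries in the first three rows of \<open>Theta\<close>; \<open>o'\<close> stands for $o$, which is
  reserved for composition. The lemma \<open>Theta_form\<close> shows that they determine the whole matrix.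
\<close>

definition Theta_eps :: "(nat \<Rightarrow> nat \<Rightarrow> nat \<Rightarrow> real) \<Rightarrow> real \<Rightarrow> complex \<Rightarrow> complex mat" where
  "Theta_eps J T \<epsilon> =
    (let \<theta> = (\<lambda>r c. complex_of_real (Theta J T $$ (r, c)));
         a = \<theta> 0 0; d = \<theta> 0 1; e = \<theta> 0 2; f = \<theta> 0 3; g = \<theta> 0 4; h = \<theta> 0 5; i = \<theta> 0 6; j = \<theta> 0 7; k = \<theta> 0 8;
         l = \<theta> 1 0; b = \<theta> 1 1; m = \<theta> 1 2; n = \<theta> 1 3; o' = \<theta> 1 4; p = \<theta> 1 5; q = \<theta> 1 6; r = \<theta> 1 7; s = \<theta> 1 8;
         t = \<theta> 2 0; u = \<theta> 2 1; c = \<theta> 2 2; v = \<theta> 2 3; w = \<theta> 2 4; x = \<theta> 2 5; y = \<theta> 2 6; z = \<theta> 2 7; A = \<theta> 2 8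
     in mat_of_rows_list 3
       [[a + g * \<epsilon> + k * \<epsilon>^2,  d + h * \<epsilon> + i * \<epsilon>^2, e + f * \<epsilon> + j * \<epsilon>^2],
        [l + o' * \<epsilon> + s * \<epsilon>^2, b + p * \<epsilon> + q * \<epsilon>^2, m + n * \<epsilon> + r * \<epsilon>^2],
        [t + w * \<epsilon> + A * \<epsilon>^2,  u + x * \<epsilon> + y * \<epsilon>^2, c + v * \<epsilon> + z * \<epsilon>^2]])"

lemma delta_shift:
  "delta [((s0 + 1) mod 3), m1 + ((s1 + 1) mod 3), m2 + ((s2 + 1) mod 3), m3 + ((s3 + 1) mod 3)] =
   delta [s0, m1 + s1, m2 + s2, m3 + s3]"
proof -
  have *: "[(m + (s + 1) mod 3) = m + s + 1] (mod 3)" for m s :: nat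
    by (simp add: cong_def mod_simps)
  have **: "[m + (s + 1) mod 3 = m' + (s' + 1) mod 3] (mod 3) \<longleftrightarrow> [m + s = m' + s'] (mod 3)"
    for m s m' s' :: nat
    using *[of m s] *[of m' s'] cong_add_rcancel_nat[of "m + s" 1 "m' + s'" 3]
    by (simp only: cong_def)
  have "delta [0 + (s0 + 1) mod 3, m1 + (s1 + 1) mod 3, m2 + (s2 + 1) mod 3, m3 + (s3 + 1) mod 3] =
        delta [0 + s0, m1 + s1, m2 + s2, m3 + s3]"
    unfolding delta_def by (simp only: list.set ball_simps **)
  then show ?thesis
    by (simp only: add_0)
qed

lemma H_shift:
  "H J ((s0 + 1) mod 3) ((s1 + 1) mod 3) ((s2 + 1) mod 3) ((s3 + 1) mod 3) = H J s0 s1 s2 s3"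
  unfolding H_def delta_shift ..

lemma Theta_form:
  fixes J :: "nat \<Rightarrow> nat \<Rightarrow> nat \<Rightarrow> real"
  shows "Theta J T =
    (let \<theta> = (\<lambda>r c. Theta J T $$ (r, c));
         a = \<theta> 0 0; d = \<theta> 0 1; e = \<theta> 0 2; f = \<theta> 0 3; g = \<theta> 0 4; h = \<theta> 0 5; i = \<theta> 0 6; j = \<theta> 0 7; k = \<theta> 0 8;
         l = \<theta> 1 0; b = \<theta> 1 1; m = \<theta> 1 2; n = \<theta> 1 3; o' = \<theta> 1 4; p = \<theta> 1 5; q = \<theta> 1 6; r = \<theta> 1 7; s = \<theta> 1 8;
         t = \<theta> 2 0; u = \<theta> 2 1; c = \<theta> 2 2; v = \<theta> 2 3; w = \<theta> 2 4; x = \<theta> 2 5; y = \<theta> 2 6; z = \<theta> 2 7; A = \<theta> 2 8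
     in mat_of_rows_list 9
       [[a, d, e, f, g, h, i, j, k],
        [l, b, m, n, o', p, q, r, s],
        [t, u, c, v, w, x, y, z, A],
        [A, y, z, c, t, u, x, v, w],
        [k, i, j, e, a, d, h, f, g],
        [s, q, r, m, l, b, p, n, o'],
        [o', p, n, r, s, q, b, m, l],
        [w, x, v, z, A, y, u, c, t],
        [g, h, f, j, k, i, d, e, a]])"
proof -
  have sh: "Theta J T $$ ((s0 + 1) mod 3 + 3 * ((s1 + 1) mod 3), (s2 + 1) mod 3 + 3 * ((s3 + 1) mod 3))
      = Theta J T $$ (s0 + 3 * s1, s2 + 3 * s3)"
    if "s0 < 3" "s1 < 3" "s2 < 3" "s3 < 3" for s0 s1 s2 s3
  proof -
    have *: "Theta J T $$ (s0 + 3 * s1, s2 + 3 * s3) = exp (- H J s0 s1 s2 s3 / T)"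
      if "s0 < 3" "s1 < 3" "s2 < 3" "s3 < 3" for s0 s1 s2 s3
      using that by (simp add: Theta_def)
    show ?thesis
      using that by (simp add: * H_shift[simplified])
  qed
  have all9: "(\<forall>n<9. P n) \<longleftrightarrow> P 0 \<and> P 1 \<and> P 2 \<and> P 3 \<and> P 4 \<and> P 5 \<and> P 6 \<and> P 7 \<and> P 8"
    for P :: "nat \<Rightarrow> bool"
    by (simp add: numeral_eq_Suc All_less_Suc conj_ac)
  note s1 = sh[of _ 0] sh[of _ 1]
  note s2 = s1[of 0] s1[of 1] s1[of 2]
  note s3 = s2[of 0] s2[of 1] s2[of 2]
  note shs = s3[of 0, simplified, folded numeral_2_eq_2] s3[of 1, simplified, folded numeral_2_eq_2] s3[of 2, simplified, folded numeral_2_eq_2]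
  show ?thesis (is "_ = ?R")
  proof (rule eq_matI)
    have dims: "dim_row ?R = 9" "dim_col ?R = 9"
      by (simp_all add: Let_def mat_of_rows_list_def)
    then show "dim_row (Theta J T) = dim_row ?R" "dim_col (Theta J T) = dim_col ?R"
      by (simp_all only: Theta_def dim_row_mat dim_col_mat)
    have "\<forall>r<9. \<forall>c<9. Theta J T $$ (r, c) = ?R $$ (r, c)"
      unfolding Let_def mat_of_rows_list_def all9
      by (simp add: shs)
    then show "Theta J T $$ (r, c) = ?R $$ (r, c)" if "r < dim_row ?R" "c < dim_col ?R" for r c
      using that unfolding dims by (elim allE impE)
  qed
qed


section \<open>Eigenvalues\<close>

definition E :: "complex set" where
  "E = {1, exp (2 * of_real pi * \<i> / 3), exp (4 * of_real pi * \<i> / 3)}"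

text \<open>
  \<open>lam \<epsilon> 1, lam \<epsilon> 2, lam \<epsilon> 3\<close> are the eigenvalues of the matrix \<open>Theta_eps J T \<epsilon>\<close>, listed in any
  order with their algebraic multiplicities.
\<close>

definition eigenvalue_numbering ::
    "(nat \<Rightarrow> nat \<Rightarrow> nat \<Rightarrow> real) \<Rightarrow> real \<Rightarrow> (complex \<Rightarrow> nat \<Rightarrow> complex) \<Rightarrow> bool" where
  "eigenvalue_numbering J T lam \<longleftrightarrow>
     (\<forall>\<epsilon>\<in>E. char_poly (Theta_eps J T \<epsilon>) = (\<Prod>k\<in>{1..3}. [:- lam \<epsilon> k, 1:]))"

text \<open>
  The single largest real eigenvalue: a real eigenvalue that is algebraically simple and exceeds
  the modulus of every other eigenvalue, hence in particular every other real eigenvalue.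
\<close>

definition principal_eigenvalue :: "complex mat \<Rightarrow> real \<Rightarrow> bool" where
  "principal_eigenvalue M r \<longleftrightarrow>
     eigenvalue M (of_real r) \<and> order (of_real r) (char_poly M) = 1 \<and>
     (\<forall>z. eigenvalue M z \<and> z \<noteq> of_real r \<longrightarrow> cmod z < r)"

text \<open>
  Cardano's formula for $x^3 + B x^2 + C x + D = 0$ with real coefficients. For
  $\Delta \ge 0$ the roots are real square and cube roots. For $\Delta < 0$ (three distinct real
  solutions) they are the principal complex ones, a choice that selects the largest solution.
\<close>

definition cardano :: "real \<Rightarrow> real \<Rightarrow> real \<Rightarrow> complex" where
  "cardano B C D =
    (let p = C - B^2 / 3;
         q = 2 * B^3 / 27 - B * C / 3 + D;
         \<Delta> = (q / 2)^2 + (p / 3)^3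
     in if \<Delta> \<ge> 0
        then of_real (root 3 (- q / 2 + sqrt \<Delta>) + root 3 (- q / 2 - sqrt \<Delta>) - B / 3)
        else (of_real (- q / 2) + csqrt (of_real \<Delta>)) powr (1 / 3)
           + (of_real (- q / 2) - csqrt (of_real \<Delta>)) powr (1 / 3) - of_real (B / 3))"

end

theory Submission
  imports Defs "Jordan_Normal_Form.Schur_Decomposition"
begin

text \<open>
  States of a cell fall into three orbits \<open>{(s + t, t)}\<close> under the simultaneous cyclic shift of both
  spins, and \<open>Theta\<close> commutes with this shift. A discrete Fourier transform along the orbits
  therefore conjugates \<open>Theta\<close> to the block diagonal matrix with blocks \<open>Theta_eps\<close>, one for each
  cubic root of unity, and \<open>Z\<^sub>L\<close> is the trace of the \<open>L\<close>-th power of \<open>Theta\<close>. The block for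
  \<open>\<epsilon> = 1\<close> is positive, so it has a Perron root; the entries of the other two blocks are strictly
  smaller in modulus, so all their eigenvalues are strictly below that root. The derivative of the
  cubic at the Perron root is a sum of positive principal minors, hence the root is simple, and
  Cardano's formula with the stated choice of branches yields the largest real root. Conjugation
  symmetry holds because the entries of \<open>Theta\<close> are real.
\<close>

section \<open>Perron eigenvectors and comparison of spectra\<close>

text \<open>Brouwer's theorem on the standard simplex. Applying the matrix and dividing by the
  coordinate sum \<open>s x\<close> is a continuous self-map of the simplex, and a fixed point is an
  eigenvector with eigenvalue \<open>s x\<close>. It is positive because a positive matrix sends
  every nonzero nonnegative vector to a positive one.\<close>

lemma positive_eigenvector_exists:
  fixes a :: "'n::finite \<Rightarrow> 'n \<Rightarrow> real"
  assumes pos: "\<And>i j. a i j > 0"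
  obtains r x where "\<And>i. x i > 0" "\<And>i. (\<Sum>j\<in>UNIV. a i j * x j) = r * x i"
proof -
  define S :: "(real^'n) set" where "S = {x. (\<forall>i. 0 \<le> vec_nth x i) \<and> (\<Sum>i\<in>UNIV. vec_nth x i) = 1}"
  define s where "s x = (\<Sum>i\<in>UNIV. \<Sum>j\<in>UNIV. a i j * vec_nth x j)" for x :: "real^'n"
  define f :: "real^'n \<Rightarrow> real^'n" where "f x = (\<chi> i. (\<Sum>j\<in>UNIV. a i j * vec_nth x j) / s x)" for x
  have row: "(\<Sum>j\<in>UNIV. a i j * vec_nth x j) > 0" if "x \<in> S" for x i
  proof -
    have nn: "\<forall>i. 0 \<le> vec_nth x i" and "(\<Sum>i\<in>UNIV. vec_nth x i) = 1" using that by (auto simp: S_def)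
    then obtain k where "vec_nth x k \<noteq> 0" by (metis sum.neutral zero_neq_one)
    with nn have "vec_nth x k > 0" by (simp add: less_le)
    with nn pos show ?thesis
      by (intro sum_pos2[of _ k]) (auto simp: less_imp_le)
  qed
  have spos: "s x > 0" if "x \<in> S" for x
    unfolding s_def by (rule sum_pos) (use row[OF that] in auto)
  have "closed S"
    unfolding S_def by (intro closed_Collect_conj closed_Collect_all closed_Collect_le closed_Collect_eq continuous_intros)
  moreover have "bounded S"
  proof (rule boundedI)
    fix x assume x: "x \<in> S"
    have "norm x \<le> (\<Sum>i\<in>UNIV. \<bar>vec_nth x i\<bar>)" by (rule norm_le_l1_cart)
    also have "\<dots> = 1" using x by (simp add: S_def)
    finally show "norm x \<le> 1" .
  qed
  ultimately have "compact S" by (simp add: compact_eq_bounded_closed)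
  moreover have "convex S"
    unfolding S_def convex_def
    by (auto simp: sum.distrib sum_distrib_left[symmetric])
  moreover have "S \<noteq> {}"
  proof -
    have "(\<chi> i. 1 / real CARD('n)) \<in> S" by (simp add: S_def)
    then show ?thesis by blast
  qed
  moreover have "continuous_on S f"
  proof -
    have "continuous_on S s" unfolding s_def by (intro continuous_intros)
    moreover have "\<forall>x\<in>S. s x \<noteq> 0" using spos by force
    ultimately show ?thesis unfolding f_def by (intro continuous_intros) auto
  qed
  moreover have "f \<in> S \<rightarrow> S"
  proof
    fix x assume x: "x \<in> S"
    have "(\<Sum>i\<in>UNIV. (\<Sum>j\<in>UNIV. a i j * vec_nth x j) / s x) = s x / s x"
      unfolding s_def sum_divide_distrib ..
    then show "f x \<in> S"
      using row[OF x] spos[OF x] by (auto simp: S_def f_def intro!: divide_nonneg_nonneg less_imp_le)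
  qed
  ultimately obtain x where x: "x \<in> S" and fx: "f x = x"
    using brouwer by blast
  have eq: "vec_nth x i = (\<Sum>j\<in>UNIV. a i j * vec_nth x j) / s x" for i
    using arg_cong[OF fx, of "\<lambda>v. vec_nth v i"] by (simp add: f_def)
  show ?thesis
  proof
    show "vec_nth x i > 0" for i
      using row[OF x] spos[OF x] by (subst eq) simp
    show "(\<Sum>j\<in>UNIV. a i j * vec_nth x j) = s x * vec_nth x i" for i
      using spos[OF x] by (subst (2) eq) simp
  qed
qed

lemma eigenvalue_scalarE:
  fixes A :: "'a :: field mat"
  assumes A: "A \<in> carrier_mat n n" and "eigenvalue A z"
  obtains u where "\<exists>i<n. u i \<noteq> 0" "\<And>i. i < n \<Longrightarrow> (\<Sum>j<n. A $$ (i, j) * u j) = z * u i"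
proof -
  obtain v where v: "v \<in> carrier_vec n" "v \<noteq> 0\<^sub>v n" "A *\<^sub>v v = z \<cdot>\<^sub>v v"
    using assms by (auto simp: eigenvalue_def eigenvector_def)
  show ?thesis
  proof
    show "\<exists>i<n. vec_index v i \<noteq> 0" using v by (auto simp: vec_eq_iff)
    fix i assume i: "i < n"
    have "(\<Sum>j<n. A $$ (i, j) * vec_index v j) = vec_index (A *\<^sub>v v) i"
      using A i v(1) by (simp add: scalar_prod_def atLeast0LessThan)
    also have "\<dots> = z * vec_index v i" unfolding v(3) using i v(1) by simp
    finally show "(\<Sum>j<n. A $$ (i, j) * vec_index v j) = z * vec_index v i" .
  qed
qed

text \<open>The index at which \<open>cmod (u i) / x i\<close> is largest exhibits the strict inequality.\<close>

lemma dominated_eigenvalue_less: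
  fixes A :: "complex mat"
  assumes A: "A \<in> carrier_mat n n" and ev: "eigenvalue A z"
    and x: "\<And>i. i < n \<Longrightarrow> x i > 0"
    and dom: "\<And>i j. i < n \<Longrightarrow> j < n \<Longrightarrow> cmod (A $$ (i, j)) < b i j"
    and bx: "\<And>i. i < n \<Longrightarrow> (\<Sum>j<n. b i j * x j) = r * x i"
  shows "cmod z < r"
proof -
  obtain u where u0: "\<exists>i<n. u i \<noteq> 0" and u: "\<And>i. i < n \<Longrightarrow> (\<Sum>j<n. A $$ (i, j) * u j) = z * u i"
    by (rule eigenvalue_scalarE[OF A ev]) blast
  define M where "M = Max ((\<lambda>i. cmod (u i) / x i) ` {..<n})"
  have n: "n \<noteq> 0" using u0 by auto
  have "M \<in> (\<lambda>i. cmod (u i) / x i) ` {..<n}" unfolding M_def using n by (intro Max_in) auto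
  then obtain i where i: "i < n" "M = cmod (u i) / x i" by auto
  have le: "cmod (u j) \<le> M * x j" if "j < n" for j
  proof -
    have "cmod (u j) / x j \<le> M" unfolding M_def using that by (intro Max_ge) auto
    then show ?thesis using x[OF that] by (simp add: field_simps)
  qed
  have M: "M > 0"
  proof -
    obtain j where j: "j < n" "u j \<noteq> 0" using u0 by auto
    have "0 < M * x j" using le[OF j(1)] j by (meson less_le_trans zero_less_norm_iff)
    then show ?thesis using x[OF j(1)] by (simp add: zero_less_mult_iff)
  qed
  have "cmod z * (M * x i) = cmod (\<Sum>j<n. A $$ (i, j) * u j)"
    using u[OF i(1)] i x[OF i(1)] by (simp add: norm_mult)
  also have "\<dots> \<le> (\<Sum>j<n. cmod (A $$ (i, j)) * cmod (u j))"
    by (rule order_trans[OF norm_sum]) (simp add: norm_mult)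
  also have "\<dots> \<le> (\<Sum>j<n. cmod (A $$ (i, j)) * (M * x j))"
    using le by (intro sum_mono mult_left_mono) auto
  also have "\<dots> < (\<Sum>j<n. b i j * (M * x j))"
    using dom[OF i(1)] M x n by (intro sum_strict_mono mult_strict_right_mono) auto
  also have "\<dots> = M * (\<Sum>j<n. b i j * x j)" by (simp add: sum_distrib_left mult_ac)
  also have "\<dots> = r * (M * x i)" using bx[OF i(1)] by simp
  finally show ?thesis using M x[OF i(1)] by (simp add: mult_less_cancel_right)
qed

text \<open>A left eigenvector \<open>w\<close> for \<open>z \<noteq> r\<close> is orthogonal to \<open>x\<close>, so it is also a left eigenvector of
  the smaller nonnegative matrix \<open>a i j - m * x i\<close>.\<close>

lemma nonprincipal_eigenvalue_less:
  fixes a :: "nat \<Rightarrow> nat \<Rightarrow> real"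
  assumes A: "A \<in> carrier_mat n n" and ev: "eigenvalue A z" and zr: "z \<noteq> of_real r"
    and x: "\<And>i. i < n \<Longrightarrow> x i > 0"
    and a: "\<And>i j. i < n \<Longrightarrow> j < n \<Longrightarrow> a i j > 0"
    and Aa: "\<And>i j. i < n \<Longrightarrow> j < n \<Longrightarrow> A $$ (i, j) = complex_of_real (a i j)"
    and ax: "\<And>i. i < n \<Longrightarrow> (\<Sum>j<n. a i j * x j) = r * x i"
  shows "cmod z < r"
proof -
  have At: "transpose_mat A \<in> carrier_mat n n" using A by simp
  have "eigenvalue (transpose_mat A) z"
    using ev unfolding eigenvalue_root_char_poly[OF A] eigenvalue_root_char_poly[OF At]
    using A by simp
  then obtain w where w0: "\<exists>i<n. w i \<noteq> 0"
    and *: "\<And>i. i < n \<Longrightarrow> (\<Sum>j<n. transpose_mat A $$ (i, j) * w j) = z * w i"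
    using eigenvalue_scalarE[OF At] by blast
  have w: "(\<Sum>i<n. of_real (a i j) * w i) = z * w j" if "j < n" for j
  proof -
    have "(\<Sum>i<n. of_real (a i j) * w i) = (\<Sum>i<n. transpose_mat A $$ (j, i) * w i)"
      using that A Aa by simp
    then show ?thesis using * that by simp
  qed
  \<comment> \<open>Pairing \<open>w\<close> with \<open>x\<close>, once through the left and once
    through the right eigenvector equation, multiplies the same sum by \<open>z\<close> and by
    \<open>r\<close>; as \<open>z\<close> differs from \<open>r\<close>, the sum vanishes.\<close>
  have "z * (\<Sum>j<n. w j * of_real (x j)) = (\<Sum>j<n. (\<Sum>i<n. of_real (a i j) * w i) * of_real (x j))"
    using w by (simp add: sum_distrib_left mult.assoc)
  also have "\<dots> = (\<Sum>i<n. w i * of_real (\<Sum>j<n. a i j * x j))"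
    unfolding of_real_sum sum_distrib_left sum_distrib_right
    by (subst sum.swap) (simp add: mult_ac)
  also have "\<dots> = of_real r * (\<Sum>i<n. w i * of_real (x i))"
    using ax by (simp add: sum_distrib_left mult_ac)
  finally have orth: "(\<Sum>i<n. w i * of_real (x i)) = 0" using zr by simp
  \<comment> \<open>The largest constant for which every \<open>a i j - m * x i\<close> remains
    nonnegative.\<close>
  define m where "m = Min ((\<lambda>(i, j). a i j / x i) ` ({..<n} \<times> {..<n}))"
  have n: "n \<noteq> 0" using w0 by auto
  have "m \<in> (\<lambda>(i, j). a i j / x i) ` ({..<n} \<times> {..<n})" unfolding m_def using n by (intro Min_in) auto
  then have m: "m > 0" using a x by auto
  have mle: "0 \<le> a i j - m * x i" if "i < n" "j < n" for i j
  proof -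
    have "m \<le> a i j / x i" unfolding m_def using that by (intro Min_le) auto
    then show ?thesis using x[OF that(1)] by (simp add: field_simps)
  qed
  define W where "W = (\<Sum>i<n. cmod (w i) * x i)"
  have W: "W > 0"
  proof -
    obtain k where "k < n" "w k \<noteq> 0" using w0 by auto
    then show ?thesis unfolding W_def using x by (intro sum_pos2[of _ k]) (auto simp: less_imp_le)
  qed
  have each: "cmod z * cmod (w j) \<le> (\<Sum>i<n. (a i j - m * x i) * cmod (w i))" if j: "j < n" for j
  proof -
    have "z * w j = (\<Sum>i<n. of_real (a i j) * w i) - of_real m * (\<Sum>i<n. w i * of_real (x i))"
      using w[OF j] orth by simp
    also have "\<dots> = (\<Sum>i<n. of_real (a i j - m * x i) * w i)"
      by (simp add: sum_distrib_left sum_subtractf algebra_simps)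
    finally have "cmod z * cmod (w j) = cmod (\<Sum>i<n. of_real (a i j - m * x i) * w i)"
      by (simp flip: norm_mult)
    also have "\<dots> \<le> (\<Sum>i<n. cmod (of_real (a i j - m * x i) * w i))" by (rule norm_sum)
    also have "\<dots> = (\<Sum>i<n. (a i j - m * x i) * cmod (w i))"
      using mle j by (intro sum.cong refl) (simp add: norm_mult del: of_real_diff of_real_mult)
    finally show ?thesis .
  qed
  \<comment> \<open>Since \<open>x\<close> is a right eigenvector of the reduced matrix as well, now
    with eigenvalue \<open>r - m * (\<Sum>j<n. x j)\<close>, weighting the entrywise bounds by
    \<open>x\<close> bounds \<open>cmod z\<close> by this smaller number.\<close>
  have "cmod z * W = (\<Sum>j<n. (cmod z * cmod (w j)) * x j)"
    by (simp add: W_def sum_distrib_left mult.assoc)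
  also have "\<dots> \<le> (\<Sum>j<n. (\<Sum>i<n. (a i j - m * x i) * cmod (w i)) * x j)"
    using each x by (intro sum_mono mult_right_mono) (auto simp: less_imp_le)
  also have "\<dots> = (\<Sum>i<n. cmod (w i) * ((\<Sum>j<n. a i j * x j) - m * x i * (\<Sum>j<n. x j)))"
    unfolding sum_distrib_right
    by (subst sum.swap) (simp add: sum_distrib_left sum_distrib_right sum_subtractf algebra_simps)
  also have "\<dots> = (\<Sum>i<n. (r - m * (\<Sum>j<n. x j)) * (cmod (w i) * x i))"
    using ax by (intro sum.cong refl) (simp add: algebra_simps)
  also have "\<dots> = (r - m * (\<Sum>j<n. x j)) * W" by (simp add: W_def sum_distrib_left)
  finally have "cmod z \<le> r - m * (\<Sum>j<n. x j)" using W by simp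
  moreover have "(\<Sum>j<n. x j) > 0" using x n by (intro sum_pos) auto
  then have "m * (\<Sum>j<n. x j) > 0" using m by simp
  ultimately show ?thesis by linarith
qed

section \<open>Cardano's formula\<close>

text \<open>Subtract the two cubic equations and cancel \<open>y - w\<close>. This serves to refute
  the existence of a root above the one that Cardano's formula produces.\<close>

lemma cubic_largest_root_unique:
  fixes p q y w :: real
  assumes y: "y^3 + p * y + q = 0" and w: "w^3 + p * w + q = 0" and "w \<le> y" "y \<noteq> w"
  shows "y^2 + y * w + w^2 + p = 0"
proof -
  have "(y - w) * (y^2 + y * w + w^2 + p) = 0"
    using y w by (simp add: algebra_simps power2_eq_square power3_eq_cube)
  then show ?thesis using assms by simp
qed

text \<open>The two real cube roots \<open>u\<close>, \<open>v\<close> satisfy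
  \<open>u * v = - p / 3\<close> and \<open>u^3 + v^3 = - q\<close>, so the cubic is
  \<open>y - (u + v)\<close> times a sum of two squares. That sum vanishes only if
  \<open>u = v\<close> and \<open>y = - v\<close>, which is a double root and is excluded by
  \<open>simple\<close>.\<close>

lemma depressed_cubic_root_nonneg:
  fixes p q y :: real
  defines "\<Delta> \<equiv> (q / 2)^2 + (p / 3)^3"
  assumes y: "y^3 + p * y + q = 0" and simple: "3 * y^2 + p \<noteq> 0"
    and D: "\<Delta> \<ge> 0"
  shows "root 3 (- q / 2 + sqrt \<Delta>) + root 3 (- q / 2 - sqrt \<Delta>) = y"
proof -
  define u where "u = root 3 (- q / 2 + sqrt \<Delta>)"
  define v where "v = root 3 (- q / 2 - sqrt \<Delta>)"
  have u3: "u^3 = - q / 2 + sqrt \<Delta>" and v3: "v^3 = - q / 2 - sqrt \<Delta>"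
    by (simp_all add: u_def v_def odd_real_root_pow)
  have "(- q / 2 + sqrt \<Delta>) * (- q / 2 - sqrt \<Delta>) = (q / 2)^2 - (sqrt \<Delta>)^2"
    by (simp add: algebra_simps power2_eq_square)
  also have "\<dots> = (- p / 3)^3" using D by (simp add: \<Delta>_def power3_eq_cube)
  finally have "u * v = root 3 ((- p / 3)^3)"
    by (simp add: u_def v_def real_root_mult[symmetric])
  also have "\<dots> = - p / 3" by (rule odd_real_root_power_cancel) simp
  finally have p: "p = - 3 * (u * v)" by simp
  have q: "q = - (u^3 + v^3)" using u3 v3 by simp
  have "(y + (u + v) / 2)^2 + 3 / 4 * (u - v)^2 = y^2 + (u + v) * y + u^2 + v^2 - u * v"
    by (simp add: power2_eq_square field_simps)
  then have "(y - (u + v)) * ((y + (u + v) / 2)^2 + 3 / 4 * (u - v)^2) = y^3 + p * y + q"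
    unfolding p q by (simp add: power2_eq_square power3_eq_cube algebra_simps)
  then have "(y - (u + v)) * ((y + (u + v) / 2)^2 + 3 / 4 * (u - v)^2) = 0"
    using y by simp
  moreover have "(y + (u + v) / 2)^2 + 3 / 4 * (u - v)^2 \<noteq> 0"
  proof
    assume "(y + (u + v) / 2)^2 + 3 / 4 * (u - v)^2 = 0"
    moreover have "0 \<le> (y + (u + v) / 2)^2" "0 \<le> (u - v)^2" by simp_all
    ultimately have "(y + (u + v) / 2)^2 = 0" "(u - v)^2 = 0" by linarith+
    then have "u = v" "y = - v" by simp_all
    then show False using simple unfolding p by (simp add: power2_eq_square)
  qed
  ultimately show ?thesis by (simp add: u_def v_def)
qed

text \<open>The two radicands are conjugate, hence so are their principal cube roots
  \<open>u\<close> and \<open>cnj u\<close>, and their sum \<open>w\<close> is a real root. The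
  small argument of \<open>u\<close> makes \<open>w\<close> exceed \<open>cmod u\<close>, which
  leaves no room for a larger root.\<close>

lemma depressed_cubic_root_neg:
  fixes p q y :: real
  defines "\<Delta> \<equiv> (q / 2)^2 + (p / 3)^3"
  assumes y: "y^3 + p * y + q = 0"
    and largest: "\<And>z. z^3 + p * z + q = 0 \<Longrightarrow> z \<le> y" and D: "\<Delta> < 0"
  shows "(of_real (- q / 2) + csqrt (of_real \<Delta>)) powr (1 / 3)
    + (of_real (- q / 2) - csqrt (of_real \<Delta>)) powr (1 / 3) = complex_of_real y"
proof -
  define c where "c = Complex (- q / 2) (sqrt (- \<Delta>))"
  define u where "u = c powr (1 / 3)"
  have sq: "csqrt (of_real \<Delta>) = \<i> * of_real (sqrt (- \<Delta>))" using D by simp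
  have c1: "of_real (- q / 2) + csqrt (of_real \<Delta>) = c"
    and c2: "of_real (- q / 2) - csqrt (of_real \<Delta>) = cnj c"
    unfolding sq c_def by (simp_all add: complex_eq_iff)
  \<comment> \<open>This keeps \<open>c\<close> off the branch cut, so that the principal logarithm
    commutes with conjugation at \<open>c\<close>.\<close>
  have Imc: "Im c > 0" using D by (simp add: c_def)
  then have c0: "c \<noteq> 0" "c \<notin> \<real>\<^sub>\<le>\<^sub>0" by (auto simp: complex_nonpos_Reals_iff)
  have u_exp: "u = exp (Ln c / 3)" using c0 by (simp add: u_def powr_def)
  have cnju: "cnj c powr (1 / 3) = cnj u"
    using c0 by (simp add: u_exp powr_def exp_cnj cnj_Ln)
  have "u^3 = exp (3 * (Ln c / 3))" unfolding u_exp by (subst exp_of_nat_mult[symmetric]) simp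
  then have u3: "u^3 = c" using c0 by simp
  have arg: "0 < Im (Ln c)" "Im (Ln c) < pi" using Im_Ln_pos_lt_imp[OF Imc] by auto
  define R where "R = cmod u"
  have Rpos: "R > 0" by (simp add: R_def u_exp)
  \<comment> \<open>The argument of \<open>c\<close> lies strictly between 0 and pi, so that of its
    cube root \<open>u\<close> lies strictly between 0 and pi/3, where the cosine exceeds
    1/2.\<close>
  have "cos (pi / 3) < cos (Im (Ln c) / 3)" using arg by (intro cos_monotone_0_pi) auto
  then have "1 / 2 < cos (Im (Ln c) / 3)" by (simp add: cos_60)
  moreover have "Re u = R * cos (Im (Ln c) / 3)" by (simp add: u_exp R_def Re_exp)
  ultimately have Reu: "R < 2 * Re u" using Rpos by simp
  have "(R^2)^3 = (cmod (u^3))^2" by (simp add: R_def norm_power power_mult[symmetric])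
  also have "\<dots> = (q / 2)^2 - \<Delta>" unfolding u3 c_def cmod_power2 using D by simp
  also have "\<dots> = (- p / 3)^3" by (simp add: \<Delta>_def power3_eq_cube)
  finally have "R^2 = - p / 3" by (metis odd_real_root_power_cancel odd_numeral)
  then have p: "p = - 3 * R^2" by simp
  define w where "w = 2 * Re u"
  have uw: "u + cnj u = of_real w" by (simp add: w_def complex_add_cnj)
  have uR: "u * cnj u = of_real (R^2)" unfolding R_def by (rule complex_norm_square[symmetric])
  have "(u + cnj u)^3 = u^3 + cnj (u^3) + 3 * (u * cnj u) * (u + cnj u)"
    by (simp add: power3_eq_cube algebra_simps)
  also have "u^3 + cnj (u^3) = of_real (- q)" unfolding u3 by (simp add: c_def complex_eq_iff)
  finally have "complex_of_real (w^3) = of_real (- q + 3 * R^2 * w)" unfolding uw uR by simp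
  then have w: "w^3 + p * w + q = 0" unfolding of_real_eq_iff p by simp
  have wy: "w \<le> y" by (rule largest[OF w])
  have "y = w"
  proof (rule ccontr)
    \<comment> \<open>A larger root \<open>y\<close> would give
      \<open>y^2 + y * w + w^2 = 3 * R^2\<close>, but each of the three terms exceeds
      \<open>R^2\<close>.\<close>
    assume "y \<noteq> w"
    then have "y^2 + y * w + w^2 + p = 0" by (rule cubic_largest_root_unique[OF y w wy])
    moreover have "R * R < w * w" using Reu Rpos unfolding w_def by (intro mult_strict_mono) auto
    moreover have "w * w \<le> y * w" "w * w \<le> y * y"
      using wy Reu Rpos unfolding w_def by (intro mult_mono; linarith)+
    ultimately show False unfolding p power2_eq_square by linarith
  qed
  then show ?thesis unfolding c1 c2 cnju u_def[symmetric] uw by simp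
qed

text \<open>The substitution \<open>z + B / 3\<close> removes the quadratic term and carries the
  root, the derivative and the maximality over to the depressed cubic. Simplicity settles the case
  of a nonnegative discriminant term, maximality the negative one.\<close>

lemma cardano_largest_root:
  fixes B C D r :: real
  assumes root: "r^3 + B * r^2 + C * r + D = 0" and simple: "3 * r^2 + 2 * B * r + C \<noteq> 0"
    and largest: "\<And>z. z^3 + B * z^2 + C * z + D = 0 \<Longrightarrow> z \<le> r"
  shows "cardano B C D = of_real r"
proof -
  define p q where "p = C - B^2 / 3" and "q = 2 * B^3 / 27 - B * C / 3 + D"
  define \<Delta> where "\<Delta> = (q / 2)^2 + (p / 3)^3"
  have shift: "(z + B / 3)^3 + p * (z + B / 3) + q = z^3 + B * z^2 + C * z + D" for z
    by (simp add: p_def q_def field_simps power2_eq_square power3_eq_cube)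
  have y: "(r + B / 3)^3 + p * (r + B / 3) + q = 0" using root shift by simp
  have "3 * (r + B / 3)^2 + p = 3 * r^2 + 2 * B * r + C"
    by (simp add: p_def field_simps power2_eq_square)
  then have simple': "3 * (r + B / 3)^2 + p \<noteq> 0" using simple by simp
  have largest': "z \<le> r + B / 3" if "z^3 + p * z + q = 0" for z
    using largest[of "z - B / 3"] shift[of "z - B / 3"] that by simp
  show ?thesis
    using depressed_cubic_root_nonneg[OF y simple'] depressed_cubic_root_neg[OF y largest']
    unfolding cardano_def Let_def p_def[symmetric] q_def[symmetric] \<Delta>_def[symmetric]
    by (cases "\<Delta> \<ge> 0") (auto simp: algebra_simps)
qed

section \<open>Traces of powers and the partition function\<close>

lemma sum_diag_mult_comm:
  fixes A :: "'a :: comm_semiring_0 mat"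
  assumes A: "A \<in> carrier_mat n m" and B: "B \<in> carrier_mat m n"
  shows "(\<Sum>i<n. (A * B) $$ (i, i)) = (\<Sum>j<m. (B * A) $$ (j, j))"
proof -
  have "(\<Sum>i<n. (A * B) $$ (i, i)) = (\<Sum>i<n. \<Sum>j<m. A $$ (i, j) * B $$ (j, i))"
    using A B by (simp add: scalar_prod_def atLeast0LessThan)
  also have "\<dots> = (\<Sum>j<m. \<Sum>i<n. B $$ (j, i) * A $$ (i, j))"
    by (subst sum.swap) (simp add: mult.commute)
  also have "\<dots> = (\<Sum>j<m. (B * A) $$ (j, j))"
    using A B by (simp add: scalar_prod_def atLeast0LessThan)
  finally show ?thesis .
qed

lemma sum_diag_similar:
  fixes A :: "'a :: comm_ring_1 mat"
  assumes "similar_mat_wit A B P Q" and A: "A \<in> carrier_mat n n"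
  shows "(\<Sum>i<n. A $$ (i, i)) = (\<Sum>i<n. B $$ (i, i))"
proof -
  note w = similar_mat_witD2[OF A assms(1)]
  have "(\<Sum>i<n. A $$ (i, i)) = (\<Sum>i<n. ((P * B) * Q) $$ (i, i))" using w by simp
  also have "\<dots> = (\<Sum>i<n. (Q * (P * B)) $$ (i, i))"
    using w by (intro sum_diag_mult_comm) auto
  also have "Q * (P * B) = (Q * P) * B"
    using w by (intro assoc_mult_mat[symmetric]) auto
  also have "\<dots> = B" using w by simp
  finally show ?thesis .
qed

lemma upper_triangular_mult_diag:
  fixes A B :: "'a :: semiring_0 mat"
  assumes A: "A \<in> carrier_mat n n" "upper_triangular A" and B: "B \<in> carrier_mat n n" "upper_triangular B"
  shows "upper_triangular (A * B)" and "i < n \<Longrightarrow> (A * B) $$ (i, i) = A $$ (i, i) * B $$ (i, i)"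
proof -
  have zero: "A $$ (i, k) * B $$ (k, j) = 0" if "i < n" "j < n" "k < n" "k < i \<or> j < k" for i j k
    using that A B by (auto simp: upper_triangular_def)
  show "upper_triangular (A * B)"
  proof
    fix i j assume ij: "j < i" "i < dim_row (A * B)"
    then have "(A * B) $$ (i, j) = (\<Sum>k<n. A $$ (i, k) * B $$ (k, j))"
      using A B by (simp add: scalar_prod_def atLeast0LessThan)
    also have "\<dots> = 0" using ij A by (intro sum.neutral ballI zero) auto
    finally show "(A * B) $$ (i, j) = 0" .
  qed
  assume i: "i < n"
  then have "(A * B) $$ (i, i) = (\<Sum>k<n. A $$ (i, k) * B $$ (k, i))"
    using A B by (simp add: scalar_prod_def atLeast0LessThan)
  also have "\<dots> = (\<Sum>k\<in>{i}. A $$ (i, k) * B $$ (k, i))"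
    using i by (intro sum.mono_neutral_right ballI zero[OF i i]) auto
  finally show "(A * B) $$ (i, i) = A $$ (i, i) * B $$ (i, i)" by simp
qed

lemma upper_triangular_pow_diag:
  fixes A :: "'a :: semiring_1 mat"
  assumes A: "A \<in> carrier_mat n n" "upper_triangular A"
  shows "upper_triangular (A ^\<^sub>m k) \<and> (\<forall>i<n. (A ^\<^sub>m k) $$ (i, i) = A $$ (i, i) ^ k)"
proof (induction k)
  case 0
  then show ?case using A by simp
next
  case (Suc k)
  then show ?case
    using upper_triangular_mult_diag[OF pow_carrier_mat[OF A(1)] _ A, of k]
    by (simp add: power_Suc2 del: power_Suc)
qed

text \<open>Schur triangularisation works without diagonalisability: the trace is invariant under
  similarity, and the diagonal of a power of a triangular matrix consists of the powers of its
  diagonal entries.\<close>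

lemma sum_diag_pow_eq_sum_eigenvalues:
  fixes A :: "complex mat"
  assumes A: "A \<in> carrier_mat n n" and cp: "char_poly A = (\<Prod>e\<leftarrow>es. [:- e, 1:])"
  shows "(\<Sum>i<n. (A ^\<^sub>m k) $$ (i, i)) = (\<Sum>e\<leftarrow>es. e ^ k)"
proof -
  obtain B P Q where "schur_decomposition A es = (B, P, Q)" by (metis prod_cases3)
  from schur_decomposition[OF A cp this]
  have wit: "similar_mat_wit A B P Q" and ut: "upper_triangular B" and diag: "diag_mat B = es" by auto
  have B: "B \<in> carrier_mat n n" using similar_mat_witD2[OF A wit] by simp
  have "(\<Sum>i<n. (A ^\<^sub>m k) $$ (i, i)) = (\<Sum>i<n. (B ^\<^sub>m k) $$ (i, i))"
    using A by (intro sum_diag_similar[OF similar_mat_wit_pow[OF wit]]) simp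
  also have "\<dots> = (\<Sum>i<n. B $$ (i, i) ^ k)" using upper_triangular_pow_diag[OF B ut] by simp
  also have "\<dots> = (\<Sum>e\<leftarrow>es. e ^ k)"
    using B unfolding diag[symmetric] diag_mat_def
    by (simp add: sum_list_distinct_conv_sum_set atLeast0LessThan comp_def)
  finally show ?thesis .
qed

text \<open>Induction on the length of the path by splitting off its last vertex. The arbitrary
  weight \<open>g\<close> of the two end points absorbs the last factor, and it later allows the
  path to be closed to a cycle.\<close>

lemma sum_paths_eq_pow_mat:
  fixes A :: "'a :: comm_semiring_1 mat"
  assumes A: "A \<in> carrier_mat n n"
  shows "(\<Sum>s\<in>{..<Suc k} \<rightarrow>\<^sub>E {..<n}. (\<Prod>i<k. A $$ (s i, s (Suc i))) * g (s 0) (s k)) =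
    (\<Sum>a<n. \<Sum>b<n. (A ^\<^sub>m k) $$ (a, b) * g a b)"
proof (induction k arbitrary: g)
  case 0
  have "(\<Sum>a<n. \<Sum>b<n. (1\<^sub>m n) $$ (a, b) * g a b) = (\<Sum>a<n. g a a)"
    by (intro sum.cong refl) (simp add: if_distrib[of "\<lambda>x. x * _"] cong: if_cong)
  also have "\<dots> = (\<Sum>s\<in>{..<Suc 0} \<rightarrow>\<^sub>E {..<n}. g (s 0) (s 0))"
    by (rule sum.reindex_bij_witness[of _ "\<lambda>s. s 0" "\<lambda>a. \<lambda>i\<in>{..<Suc 0}. a"])
      (auto simp: PiE_def extensional_def fun_eq_iff)
  finally show ?case using A by simp
next
  case (Suc k)
  let ?P = "{..<Suc k} \<rightarrow>\<^sub>E {..<n}"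
  have "(\<Sum>s\<in>{..<Suc (Suc k)} \<rightarrow>\<^sub>E {..<n}. (\<Prod>i<Suc k. A $$ (s i, s (Suc i))) * g (s 0) (s (Suc k)))
    = (\<Sum>(c, s)\<in>{..<n} \<times> ?P. (\<Prod>i<k. A $$ (s i, s (Suc i))) * (A $$ (s k, c) * g (s 0) c))"
    \<comment> \<open>Resetting the last vertex to \<open>undefined\<close> is what membership in
      the extensional function space on the shorter index set demands.\<close>
    by (rule sum.reindex_bij_witness[of _ "\<lambda>(c, s). s(Suc k := c)" "\<lambda>s. (s (Suc k), s(Suc k := undefined))"])
      (auto simp: PiE_def Pi_def extensional_def less_Suc_eq mult.assoc intro!: arg_cong2[of _ _ _ _ "(*)"] prod.cong)
  also have "\<dots> = (\<Sum>s\<in>?P. (\<Prod>i<k. A $$ (s i, s (Suc i))) * (\<Sum>c<n. A $$ (s k, c) * g (s 0) c))"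
    unfolding sum.cartesian_product[symmetric] by (subst sum.swap) (simp add: sum_distrib_left)
  also have "\<dots> = (\<Sum>a<n. \<Sum>b<n. (A ^\<^sub>m k) $$ (a, b) * (\<Sum>c<n. A $$ (b, c) * g a c))"
    by (rule Suc.IH)
  also have "\<dots> = (\<Sum>a<n. \<Sum>c<n. (A ^\<^sub>m Suc k) $$ (a, c) * g a c)"
  proof (rule sum.cong[OF refl])
    fix a assume a: "a \<in> {..<n}"
    have "(\<Sum>b<n. (A ^\<^sub>m k) $$ (a, b) * (\<Sum>c<n. A $$ (b, c) * g a c)) =
        (\<Sum>c<n. (\<Sum>b<n. (A ^\<^sub>m k) $$ (a, b) * A $$ (b, c)) * g a c)"
      unfolding sum_distrib_left sum_distrib_right by (subst sum.swap) (simp add: mult.assoc)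
    also have "\<dots> = (\<Sum>c<n. (A ^\<^sub>m Suc k) $$ (a, c) * g a c)"
      using A a by (intro sum.cong refl) (simp add: scalar_prod_def atLeast0LessThan)
    finally show "(\<Sum>b<n. (A ^\<^sub>m k) $$ (a, b) * (\<Sum>c<n. A $$ (b, c) * g a c)) =
        (\<Sum>c<n. (A ^\<^sub>m Suc k) $$ (a, c) * g a c)" .
  qed
  finally show ?case .
qed

text \<open>A cycle of length \<open>L\<close> is a path with \<open>L - 1\<close> steps closed by
  one more factor from its end to its start; this factor is the weight \<open>g\<close>.\<close>

lemma sum_cycles_eq_sum_diag_pow:
  fixes A :: "'a :: comm_semiring_1 mat"
  assumes A: "A \<in> carrier_mat n n" and L: "L \<ge> 1"
  shows "(\<Sum>s\<in>{..<L} \<rightarrow>\<^sub>E {..<n}. \<Prod>i<L. A $$ (s i, s (Suc i mod L))) =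
    (\<Sum>i<n. (A ^\<^sub>m L) $$ (i, i))"
proof -
  obtain k where k: "L = Suc k" using L by (cases L) auto
  have "(\<Prod>i<L. A $$ (s i, s (Suc i mod L))) =
      (\<Prod>i<k. A $$ (s i, s (Suc i))) * A $$ (s k, s 0)" for s
    by (simp add: k)
  then have "(\<Sum>s\<in>{..<L} \<rightarrow>\<^sub>E {..<n}. \<Prod>i<L. A $$ (s i, s (Suc i mod L))) =
      (\<Sum>a<n. \<Sum>b<n. (A ^\<^sub>m k) $$ (a, b) * A $$ (b, a))"
    using sum_paths_eq_pow_mat[OF A, of k "\<lambda>a b. A $$ (b, a)"] by (simp add: k)
  also have "\<dots> = (\<Sum>i<n. (A ^\<^sub>m L) $$ (i, i))"
    using A by (intro sum.cong refl) (simp add: k scalar_prod_def atLeast0LessThan)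
  finally show ?thesis .
qed

section \<open>The partition function as the trace of a power of the transfer-matrix\<close>

lemma X_eq: "X = {..<3}"
  by (auto simp: X_def)

lemma Theta_carrier [simp]: "Theta J T \<in> carrier_mat 9 9"
  by (simp add: Theta_def)

lemma Theta_dim [simp]: "dim_row (Theta J T) = 9" "dim_col (Theta J T) = 9"
  by (simp_all add: Theta_def)

lemma Theta_index:
  "r < 9 \<Longrightarrow> c < 9 \<Longrightarrow> Theta J T $$ (r, c) = exp (- H J (r mod 3) (r div 3) (c mod 3) (c div 3) / T)"
  by (simp add: Theta_def)

text \<open>Coding the two spins of each cell as \<open>s + 3 * s'\<close> identifies spin
  configurations with cyclic sequences of cell states. The exponential turns the sum of the energies
  into a product of entries of \<open>Theta\<close> along such a sequence.\<close>

lemma partition_function_eq_sum_diag_pow: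
  assumes L: "L \<ge> 1"
  shows "partition_function J T L = (\<Sum>i<9. (Theta J T ^\<^sub>m L) $$ (i, i))"
proof -
  have "(\<Sum>s\<in>{..<L} \<rightarrow>\<^sub>E {..<9}. \<Prod>i<L. Theta J T $$ (s i, s (Suc i mod L))) = partition_function J T L"
    unfolding partition_function_def
  proof (rule sum.reindex_bij_witness[of _
      "\<lambda>\<sigma>. \<lambda>i\<in>{..<L}. \<sigma> (i, 0) + 3 * \<sigma> (i, 1)"
      "\<lambda>s. \<lambda>(i, j)\<in>{..<L} \<times> {0, 1}. if j = 0 then s i mod 3 else s i div 3"])
    fix s assume s: "s \<in> {..<L} \<rightarrow>\<^sub>E {..<9::nat}"
    let ?\<sigma> = "\<lambda>(i, j)\<in>{..<L} \<times> {0, 1::nat}. if j = 0 then s i mod 3 else s i div 3"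
    have s9: "s i < 9" if "i < L" for i using s that by auto
    show "(\<lambda>i\<in>{..<L}. ?\<sigma> (i, 0) + 3 * ?\<sigma> (i, 1)) = s"
      using s by (auto simp: PiE_def extensional_def fun_eq_iff)
    show "?\<sigma> \<in> ({..<L} \<times> {0, 1}) \<rightarrow>\<^sub>E X"
    proof (rule PiE_I)
      fix x assume "x \<in> {..<L} \<times> {0, 1::nat}"
      then obtain i j where x: "x = (i, j)" "i < L" "j \<in> {0, 1}" by auto
      have "s i mod 3 < 3" "s i div 3 < 3" using s9[OF x(2)] by auto
      then have "(if j = 0 then s i mod 3 else s i div 3) < 3" by simp
      then show "?\<sigma> x \<in> X" using x by (simp add: X_eq)
    qed (auto simp: restrict_def)
    have "exp (- hamiltonian J L ?\<sigma> / T) = (\<Prod>i<L. exp (- H J (s i mod 3) (s i div 3)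
        (s (Suc i mod L) mod 3) (s (Suc i mod L) div 3) / T))"
      unfolding hamiltonian_def
      by (simp add: sum_divide_distrib sum_negf[symmetric] exp_sum)
    also have "\<dots> = (\<Prod>i<L. Theta J T $$ (s i, s (Suc i mod L)))"
      using s9 L by (intro prod.cong refl) (simp add: Theta_index)
    finally show "exp (- hamiltonian J L ?\<sigma> / T) = (\<Prod>i<L. Theta J T $$ (s i, s (Suc i mod L)))" .
  next
    fix \<sigma> assume \<sigma>: "\<sigma> \<in> ({..<L} \<times> {0, 1::nat}) \<rightarrow>\<^sub>E X"
    have \<sigma>3: "\<sigma> (i, j) < 3" if "i < L" "j = 0 \<or> j = 1" for i j
      using PiE_mem[OF \<sigma>, of "(i, j)"] that by (auto simp: X_eq)
    let ?s = "\<lambda>i\<in>{..<L}. \<sigma> (i, 0) + 3 * \<sigma> (i, 1)"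
    show "?s \<in> {..<L} \<rightarrow>\<^sub>E {..<9}"
    proof
      fix i assume "i \<in> {..<L}"
      then show "?s i \<in> {..<9}" using \<sigma>3[of i 0] \<sigma>3[of i 1] by simp
    qed simp
    show "(\<lambda>(i, j)\<in>{..<L} \<times> {0, 1}. if j = 0 then ?s i mod 3 else ?s i div 3) = \<sigma>"
    proof
      fix x :: "nat \<times> nat"
      obtain i j where x: "x = (i, j)" by force
      show "(\<lambda>(i, j)\<in>{..<L} \<times> {0, 1}. if j = 0 then ?s i mod 3 else ?s i div 3) x = \<sigma> x"
        using \<sigma>3[of i 0] \<sigma>3[of i 1] PiE_arb[OF \<sigma>, of x] unfolding x by (auto simp: restrict_def)
    qed
  qed
  then show ?thesis using sum_cycles_eq_sum_diag_pow[OF Theta_carrier L, of J T] by simp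
qed

section \<open>Fourier decomposition of the transfer-matrix\<close>

text \<open>The simultaneous increment of both spins modulo 3, expressed on the index
  \<open>s + 3 * s'\<close> of a cell state.\<close>

definition shift :: "nat \<Rightarrow> nat" where
  "shift r = (r mod 3 + 1) mod 3 + 3 * ((r div 3 + 1) mod 3)"

lemma sum_lessThan_3: "(\<Sum>k<3::nat. f k) = f 0 + f 1 + f 2"
  by (simp add: eval_nat_numeral)

lemma sum_lessThan_9:
  "(\<Sum>k<9::nat. f k) = f 0 + f 1 + f 2 + f 3 + f 4 + f 5 + f 6 + f 7 + f 8"
  by (simp add: eval_nat_numeral)

lemma less_3_cases: "i < 3 \<longleftrightarrow> i = 0 \<or> i = 1 \<or> i = (2::nat)"
  by auto

lemma less_9_cases:
  "i < 9 \<longleftrightarrow> i = 0 \<or> i = 1 \<or> i = 2 \<or> i = 3 \<or> i = 4 \<or> i = 5 \<or> i = 6 \<or> i = 7 \<or> i = (8::nat)"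
  by auto

lemma shift_mod: "shift r mod 3 = (r mod 3 + 1) mod 3"
  and shift_div: "shift r div 3 = (r div 3 + 1) mod 3"
  by (simp_all add: shift_def)

lemma shift_less: "shift r < 9"
proof -
  have "(r mod 3 + 1) mod 3 < 3" "(r div 3 + 1) mod 3 < 3" by simp_all
  then show ?thesis unfolding shift_def by linarith
qed

lemma Theta_shift: "r < 9 \<Longrightarrow> c < 9 \<Longrightarrow> Theta J T $$ (shift r, shift c) = Theta J T $$ (r, c)"
  using H_shift[of J "r mod 3" "r div 3" "c mod 3" "c div 3"]
  by (simp add: Theta_index shift_less shift_mod shift_div)

lemma bij_betw_shift: "bij_betw shift {..<9} {..<9}"
  by (rule bij_betw_byWitness[of _ "shift \<circ> shift"]) (auto simp: less_9_cases shift_def)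

lemma Theta_eps_carrier [simp]: "Theta_eps J T \<epsilon> \<in> carrier_mat 3 3"
  by (rule carrier_matI) (simp_all add: Theta_eps_def Let_def mat_of_rows_list_def)

lemma Theta_eps_dim [simp]: "dim_row (Theta_eps J T \<epsilon>) = 3" "dim_col (Theta_eps J T \<epsilon>) = 3"
  using carrier_matD[OF Theta_eps_carrier] by blast+

text \<open>This exposes the entries as Fourier sums: as \<open>t\<close> varies, the column index
  runs through the orbit of the state \<open>(s', 0)\<close>, that is, through the states
  \<open>(s' + t, t)\<close>.\<close>

lemma Theta_eps_index:
  assumes "s < 3" "s' < 3"
  shows "Theta_eps J T \<epsilon> $$ (s, s') =
    (\<Sum>t<3. complex_of_real (Theta J T $$ (s, (t + s') mod 3 + 3 * t)) * \<epsilon> ^ t)"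
  using assms unfolding less_3_cases
  by (auto simp: Theta_eps_def Let_def mat_of_rows_list_def sum_lessThan_3)

text \<open>The column \<open>s\<close> of \<open>fourier_block \<epsilon>\<close> is supported on the orbit \<open>{(s + t, t)}\<close> of the cyclic
  shift of cell states and transforms with the character \<open>\<epsilon>\<close> there.\<close>

definition fourier_block :: "complex \<Rightarrow> nat \<Rightarrow> nat \<Rightarrow> complex" where
  "fourier_block \<epsilon> r s = (if r mod 3 = (r div 3 + s) mod 3 then \<epsilon> ^ (r div 3) else 0)"

text \<open>Where the second spin wraps around from 2 to 0, the factor \<open>\<epsilon>\<close>
  survives because \<open>\<epsilon> ^ 3 = 1\<close>.\<close>

lemma fourier_block_shift:
  assumes "\<epsilon> ^ 3 = 1" "r < 9" "s < 3"
  shows "fourier_block \<epsilon> (shift r) s = \<epsilon> * fourier_block \<epsilon> r s"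
  using assms unfolding less_9_cases less_3_cases
  by (elim disjE) (simp_all add: fourier_block_def shift_def power3_eq_cube power2_eq_square mult.assoc)

lemma Theta_fourier_block_shift:
  assumes "\<epsilon> ^ 3 = 1" "r < 9" "s < 3"
  shows "(\<Sum>k<9. complex_of_real (Theta J T $$ (shift r, k)) * fourier_block \<epsilon> k s) =
    \<epsilon> * (\<Sum>k<9. complex_of_real (Theta J T $$ (r, k)) * fourier_block \<epsilon> k s)"
proof -
  have "(\<Sum>k<9. complex_of_real (Theta J T $$ (shift r, k)) * fourier_block \<epsilon> k s) =
      (\<Sum>k<9. complex_of_real (Theta J T $$ (shift r, shift k)) * fourier_block \<epsilon> (shift k) s)"
    by (rule sum.reindex_bij_betw[OF bij_betw_shift, symmetric])
  also have "\<dots> = (\<Sum>k<9. complex_of_real (Theta J T $$ (r, k)) * (\<epsilon> * fourier_block \<epsilon> k s))"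
    using assms by (intro sum.cong refl) (simp add: Theta_shift fourier_block_shift)
  finally show ?thesis by (simp add: sum_distrib_left mult_ac)
qed

text \<open>Both sides are multiplied by \<open>\<epsilon>\<close> when \<open>r\<close> is shifted,
  so it suffices to compare them at one state of each orbit. The representatives are the rows 0, 1,
  2, where \<open>fourier_block\<close> reduces to the identity matrix.\<close>

lemma Theta_fourier_block:
  assumes \<epsilon>: "\<epsilon> ^ 3 = 1" and r: "r < 9" and s: "s < 3"
  shows "(\<Sum>k<9. complex_of_real (Theta J T $$ (r, k)) * fourier_block \<epsilon> k s) =
    (\<Sum>s'<3. fourier_block \<epsilon> r s' * Theta_eps J T \<epsilon> $$ (s', s))" (is "?L r = ?R r")
proof -
  have base: "?L r = ?R r" if "r < 3" for r
  proof -
    have "?R r = Theta_eps J T \<epsilon> $$ (r, s)"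
      using that unfolding less_3_cases by (auto simp: sum_lessThan_3 fourier_block_def)
    also have "\<dots> = ?L r"
      using s that unfolding Theta_eps_index[OF that s] unfolding less_3_cases
      by (elim disjE) (simp_all add: sum_lessThan_3 sum_lessThan_9 fourier_block_def flip: numeral_2_eq_2)
    finally show ?thesis by simp
  qed
  have step: "?L (shift r) = ?R (shift r)" if "r < 9" "?L r = ?R r" for r
  proof -
    have "?R (shift r) = \<epsilon> * ?R r"
      using \<epsilon> that(1) by (simp add: sum_distrib_left fourier_block_shift mult.assoc)
    then show ?thesis using Theta_fourier_block_shift[OF \<epsilon> that(1) s] that(2) by simp
  qed
  have step1: "?L (shift r) = ?R (shift r)" if "r < 3" for r
    using that by (intro step base) auto
  have step2: "?L (shift (shift r)) = ?R (shift (shift r))" if "r < 3" for r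
    by (rule step[OF shift_less step1[OF that]])
  have "r < 3 \<or> (\<exists>s<3. r = shift s) \<or> (\<exists>s<3. r = shift (shift s))"
    using r unfolding less_9_cases less_3_cases
    by (elim disjE) (simp_all add: shift_def conj_disj_distribR ex_disj_distrib)
  then show ?thesis using base step1 step2 by blast
qed

text \<open>Columns for different \<open>s\<close> have disjoint supports. The pairing is bilinear,
  without conjugation, so a column is paired to 3 with the one for the inverse character.\<close>

lemma sum_fourier_block_mult:
  assumes "s < 3" "s' < 3"
  shows "(\<Sum>r<9. fourier_block \<epsilon> r s * fourier_block \<epsilon>' r s') = (if s = s' then \<Sum>t<3. (\<epsilon> * \<epsilon>') ^ t else 0)"
  using assms unfolding less_3_cases
  by (elim disjE) (simp_all add: sum_lessThan_9 sum_lessThan_3 fourier_block_def power_mult_distrib)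

lemma sum_powers_cube_root:
  fixes \<omega> :: complex
  assumes \<omega>3: "\<omega> ^ 3 = 1" and \<omega>: "1 + \<omega> + \<omega>\<^sup>2 = 0"
  shows "(\<Sum>t<3. (\<omega> ^ m) ^ t) = (if 3 dvd m then 3 else 0)"
proof -
  have "\<omega> ^ m = (\<omega> ^ 3) ^ (m div 3) * \<omega> ^ (m mod 3)"
    unfolding power_mult[symmetric] power_add[symmetric] by simp
  then have eq: "\<omega> ^ m = \<omega> ^ (m mod 3)" using \<omega>3 by simp
  have "m mod 3 = 0 \<or> m mod 3 = 1 \<or> m mod 3 = 2" by presburger
  then show ?thesis
  proof (elim disjE)
    assume 2: "m mod 3 = 2"
    have "(\<omega>\<^sup>2)\<^sup>2 = \<omega> ^ 3 * \<omega>" by (simp add: power2_eq_square power3_eq_cube)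
    then have "1 + \<omega>\<^sup>2 + (\<omega>\<^sup>2)\<^sup>2 = 0" using \<omega> \<omega>3 by (simp add: algebra_simps)
    then show ?thesis using 2 by (simp add: eq sum_lessThan_3 dvd_eq_mod_eq_0)
  qed (use \<omega> in \<open>simp_all add: eq sum_lessThan_3 dvd_eq_mod_eq_0\<close>)
qed

text \<open>Column \<open>c\<close> belongs to character number \<open>c div 3\<close> and orbit
  \<open>c mod 3\<close>, which makes the columns of each character contiguous.\<close>

definition fourier_mat :: "complex \<Rightarrow> complex mat" where
  "fourier_mat \<omega> = mat 9 9 (\<lambda>(r, c). fourier_block (\<omega> ^ (c div 3)) r (c mod 3))"

definition block_diag :: "complex mat \<Rightarrow> complex mat \<Rightarrow> complex mat \<Rightarrow> complex mat" where
  "block_diag A B C = four_block_mat A (0\<^sub>m 3 6) (0\<^sub>m 6 3) (four_block_mat B (0\<^sub>m 3 3) (0\<^sub>m 3 3) C)"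

lemma block_diag_carrier:
  assumes "A \<in> carrier_mat 3 3" "B \<in> carrier_mat 3 3" "C \<in> carrier_mat 3 3"
  shows "block_diag A B C \<in> carrier_mat 9 9"
  using assms unfolding block_diag_def by auto

lemma block_diag_index:
  assumes "A \<in> carrier_mat 3 3" "B \<in> carrier_mat 3 3" "C \<in> carrier_mat 3 3" "r < 9" "c < 9"
  shows "block_diag A B C $$ (r, c) =
    (if r div 3 = c div 3 then ([A, B, C] ! (c div 3)) $$ (r mod 3, c mod 3) else 0)"
proof -
  have div: "k div 3 = (if k < 3 then 0 else if k < 6 then 1 else 2)"
    and mod: "k mod 3 = (if k < 3 then k else if k < 6 then k - 3 else k - 6)" if "k < 9" for k :: nat
    using that unfolding less_9_cases by (elim disjE; simp)+
  have sub: "k - 3 < 3 \<longleftrightarrow> k < 6" "k - 3 - 3 = k - 6" for k :: nat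
    by auto
  show ?thesis
    using assms(1-5) unfolding block_diag_def div[OF assms(4)] div[OF assms(5)] mod[OF assms(4)] mod[OF assms(5)]
    by (cases "r < 3"; cases "c < 3"; cases "r < 6"; cases "c < 6"; simp add: sub)
qed

lemma char_poly_block_diag:
  assumes ABC: "A \<in> carrier_mat 3 3" "B \<in> carrier_mat 3 3" "C \<in> carrier_mat 3 3"
  shows "char_poly (block_diag A B C) = char_poly A * (char_poly B * char_poly C)"
proof -
  let ?BC = "four_block_mat B (0\<^sub>m 3 3) (0\<^sub>m 3 3) C"
  have BC: "?BC \<in> carrier_mat 6 6" using ABC by auto
  have lin: "\<exists>es. char_poly M = (\<Prod>a\<leftarrow>es. [:- a, 1:])" if "M \<in> carrier_mat n n" for M :: "complex mat" and n
    using char_poly_factorized[OF that] by blast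
  have "char_poly ?BC = char_poly B * char_poly C"
    using ABC lin by (intro char_poly_0_block[OF refl]) auto
  moreover have "char_poly (block_diag A B C) = char_poly A * char_poly ?BC"
    unfolding block_diag_def using ABC BC lin by (intro char_poly_0_block[OF refl]) auto
  ultimately show ?thesis by simp
qed

text \<open>Column by column, \<open>Theta_fourier_block\<close> says that the Fourier matrix
  intertwines \<open>Theta\<close> with the block diagonal matrix; orthogonality of characters
  supplies the inverse.\<close>

lemma Theta_similar_block_diag:
  assumes \<omega>3: "\<omega> ^ 3 = 1" and \<omega>: "1 + \<omega> + \<omega>\<^sup>2 = 0"
  shows "similar_mat (map_mat complex_of_real (Theta J T))
    (block_diag (Theta_eps J T 1) (Theta_eps J T \<omega>) (Theta_eps J T (\<omega>\<^sup>2)))"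
    (is "similar_mat ?\<Theta> ?D")
proof -
  let ?P = "fourier_mat \<omega>"
  \<comment> \<open>Squaring a cubic root of unity inverts it, hence the exponent; the divisor 3 is
    the length of an orbit.\<close>
  define Q where "Q = mat 9 9 (\<lambda>(c, r). fourier_block (\<omega> ^ (2 * (c div 3))) r (c mod 3) / 3)"
  have carr: "?\<Theta> \<in> carrier_mat 9 9" "?P \<in> carrier_mat 9 9" "Q \<in> carrier_mat 9 9" "?D \<in> carrier_mat 9 9"
    by (auto simp: fourier_mat_def Q_def Theta_def intro!: block_diag_carrier)
  have QP: "Q * ?P = 1\<^sub>m 9"
  proof (rule eq_matI)
    fix c c' :: nat assume "c < dim_row (1\<^sub>m 9 :: complex mat)" "c' < dim_col (1\<^sub>m 9 :: complex mat)"
    then have c: "c < 9" "c' < 9" by auto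
    then have "(Q * ?P) $$ (c, c') =
        (\<Sum>r<9. fourier_block (\<omega> ^ (2 * (c div 3))) r (c mod 3) / 3 * fourier_block (\<omega> ^ (c' div 3)) r (c' mod 3))"
      by (simp add: Q_def fourier_mat_def scalar_prod_def atLeast0LessThan)
    also have "\<dots> = (\<Sum>r<9. fourier_block (\<omega> ^ (2 * (c div 3))) r (c mod 3) * fourier_block (\<omega> ^ (c' div 3)) r (c' mod 3)) / 3"
      by (simp add: sum_divide_distrib)
    also have "\<dots> = (if c mod 3 = c' mod 3 then \<Sum>t<3. (\<omega> ^ (2 * (c div 3) + c' div 3)) ^ t else 0) / 3"
      by (subst sum_fourier_block_mult) (simp_all add: power_add)
    also have "\<dots> = (if c mod 3 = c' mod 3 \<and> 3 dvd 2 * (c div 3) + c' div 3 then 1 else 0)"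
      by (subst sum_powers_cube_root[OF \<omega>3 \<omega>]) simp
    \<comment> \<open>Modulo 3 the factor 2 is -1, so divisibility means that the two block numbers
      agree.\<close>
    also have "3 dvd 2 * (c div 3) + c' div 3 \<longleftrightarrow> c div 3 = c' div 3"
    proof -
      have "c div 3 < 3" "c' div 3 < 3" using c by auto
      then show ?thesis unfolding less_3_cases by (elim disjE) (simp_all flip: numeral_2_eq_2)
    qed
    also have "c mod 3 = c' mod 3 \<and> c div 3 = c' div 3 \<longleftrightarrow> c = c'"
      by (metis div_mult_mod_eq)
    also have "(if c = c' then 1 else 0) = (1\<^sub>m 9) $$ (c, c')"
      using c by simp
    finally show "(Q * ?P) $$ (c, c') = (1\<^sub>m 9) $$ (c, c')" .
  qed (use carr in auto)
  then have PQ: "?P * Q = 1\<^sub>m 9" using mat_mult_left_right_inverse[OF carr(3,2)] by simp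
  have "?\<Theta> * ?P = ?P * ?D"
  proof (rule eq_matI)
    fix r c assume "r < dim_row (?P * ?D)" "c < dim_col (?P * ?D)"
    then have rc: "r < 9" "c < 9" using carr by auto
    define e s where "e = c div 3" and "s = c mod 3"
    have es: "e < 3" "s < 3" using rc by (auto simp: e_def s_def)
    have eps: "([Theta_eps J T 1, Theta_eps J T \<omega>, Theta_eps J T (\<omega>\<^sup>2)] ! e) = Theta_eps J T (\<omega> ^ e)"
      using es(1) by (auto simp: less_3_cases)
    have D_index: "?D $$ (k, c) = (if k div 3 = e then Theta_eps J T (\<omega> ^ e) $$ (k mod 3, s) else 0)"
      if "k < 9" for k
      unfolding block_diag_index[OF Theta_eps_carrier Theta_eps_carrier Theta_eps_carrier that rc(2)]
      unfolding e_def[symmetric] s_def[symmetric] eps ..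
    have "(?\<Theta> * ?P) $$ (r, c) = (\<Sum>k<9. complex_of_real (Theta J T $$ (r, k)) * fourier_block (\<omega> ^ e) k s)"
      using rc carr by (simp add: fourier_mat_def scalar_prod_def atLeast0LessThan e_def s_def)
    also have "\<dots> = (\<Sum>s'<3. fourier_block (\<omega> ^ e) r s' * Theta_eps J T (\<omega> ^ e) $$ (s', s))"
      using \<omega>3 rc es by (intro Theta_fourier_block) (simp_all add: power_mult[symmetric] mult.commute[of e] power_mult)
    also have "\<dots> = (\<Sum>k<9. fourier_block (\<omega> ^ (k div 3)) r (k mod 3) *
        (if k div 3 = e then Theta_eps J T (\<omega> ^ e) $$ (k mod 3, s) else 0))"
      using es(1) unfolding less_3_cases
      by (elim disjE) (simp_all add: sum_lessThan_9 sum_lessThan_3 flip: numeral_2_eq_2)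
    also have "\<dots> = (\<Sum>k<9. ?P $$ (r, k) * ?D $$ (k, c))"
      using rc D_index by (simp add: fourier_mat_def)
    also have "\<dots> = (?P * ?D) $$ (r, c)"
      using rc carr by (simp add: scalar_prod_def atLeast0LessThan)
    finally show "(?\<Theta> * ?P) $$ (r, c) = (?P * ?D) $$ (r, c)" .
  qed (use carr in auto)
  then have "?P * ?D * Q = ?\<Theta> * ?P * Q" by simp
  also have "\<dots> = ?\<Theta> * (?P * Q)" using carr by (intro assoc_mult_mat) auto
  also have "\<dots> = ?\<Theta>" unfolding PQ using carr by simp
  finally have "?\<Theta> = ?P * ?D * Q" by simp
  then show ?thesis
    using carr PQ QP by (intro similar_matI[of _ _ ?P Q 9]) auto
qed

section \<open>Principal eigenvalues in dimension three\<close>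

lemma det_2:
  fixes A :: "'a :: comm_ring_1 mat"
  assumes A: "A \<in> carrier_mat 2 2"
  shows "det A = A $$ (0, 0) * A $$ (1, 1) - A $$ (0, 1) * A $$ (1, 0)"
proof -
  have minor: "det (mat_delete A 0 j) = mat_delete A 0 j $$ (0, 0)" if "j < 2" for j
    using A that by (intro det_single) (auto simp: mat_delete_def)
  have "det A = (\<Sum>j<2. A $$ (0, j) * cofactor A 0 j)"
    using laplace_expansion_row[OF A, of 0] by simp
  also have "\<dots> = (\<Sum>j<2. A $$ (0, j) * ((- 1) ^ j * mat_delete A 0 j $$ (0, 0)))"
    by (intro sum.cong refl) (simp add: cofactor_def minor)
  finally show ?thesis
    using A by (simp add: numeral_2_eq_2 mat_delete_def)
qed

lemma det_3:
  fixes A :: "'a :: comm_ring_1 mat"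
  assumes A: "A \<in> carrier_mat 3 3"
  shows "det A = A $$ (0, 0) * (A $$ (1, 1) * A $$ (2, 2) - A $$ (1, 2) * A $$ (2, 1))
    - A $$ (0, 1) * (A $$ (1, 0) * A $$ (2, 2) - A $$ (1, 2) * A $$ (2, 0))
    + A $$ (0, 2) * (A $$ (1, 0) * A $$ (2, 1) - A $$ (1, 1) * A $$ (2, 0))"
proof -
  have minor: "det (mat_delete A 0 j) = mat_delete A 0 j $$ (0, 0) * mat_delete A 0 j $$ (1, 1)
      - mat_delete A 0 j $$ (0, 1) * mat_delete A 0 j $$ (1, 0)" if "j < 3" for j
    using A that by (intro det_2) (auto simp: mat_delete_def)
  have "det A = (\<Sum>j<3. A $$ (0, j) * cofactor A 0 j)"
    using laplace_expansion_row[OF A, of 0] by simp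
  also have "\<dots> = (\<Sum>j<3. A $$ (0, j) * ((- 1) ^ j * (mat_delete A 0 j $$ (0, 0) * mat_delete A 0 j $$ (1, 1)
      - mat_delete A 0 j $$ (0, 1) * mat_delete A 0 j $$ (1, 0))))"
    by (intro sum.cong refl) (simp add: cofactor_def minor)
  finally show ?thesis
    using A by (simp add: sum_lessThan_3 mat_delete_def algebra_simps flip: numeral_2_eq_2)
qed

lemma char_poly_3:
  fixes A :: "'a :: comm_ring_1 mat"
  assumes A: "A \<in> carrier_mat 3 3"
  defines "m \<equiv> \<lambda>i j. A $$ (i, i) * A $$ (j, j) - A $$ (i, j) * A $$ (j, i)"
  shows "char_poly A =
    [:- det A, m 0 1 + m 0 2 + m 1 2, - (A $$ (0, 0) + A $$ (1, 1) + A $$ (2, 2)), 1:]"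
proof -
  have M: "char_poly_matrix A \<in> carrier_mat 3 3" using A by simp
  have idx: "char_poly_matrix A $$ (i, j) = (if i = j then [:- A $$ (i, j), 1:] else [:- A $$ (i, j):])"
    if "i < 3" "j < 3" for i j
    using A that by (simp add: char_poly_matrix_def)
  show ?thesis
    unfolding char_poly_def det_3[OF M] det_3[OF A] m_def
    by (simp add: idx algebra_simps)
qed

lemma order_eq_1I:
  fixes p :: "'a :: field_char_0 poly"
  assumes "poly p a = 0" "poly (pderiv p) a \<noteq> 0"
  shows "Polynomial.order a p = 1"
proof -
  have "p \<noteq> 0" "pderiv p \<noteq> 0" using assms by auto
  moreover have "Polynomial.order a (pderiv p) = 0" using assms(2) order_root by blast
  moreover have "Polynomial.order a p \<noteq> 0" using assms(1) \<open>p \<noteq> 0\<close> order_root by blast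
  ultimately show ?thesis using order_pderiv2[of p a 0] by simp
qed

text \<open>The triangle inequality is strict because \<open>Re \<epsilon> < 1\<close> for a unit
  \<open>\<epsilon>\<close> other than 1; this makes the cross term of the squared modulus
  smaller.\<close>

lemma cmod_add_unit_less:
  assumes "0 < x" "0 < y" "cmod \<epsilon> = 1" "\<epsilon> \<noteq> 1"
  shows "cmod (of_real x + of_real y * \<epsilon>) < x + y"
proof -
  have e: "(Re \<epsilon>)\<^sup>2 + (Im \<epsilon>)\<^sup>2 = 1" using assms(3) by (metis cmod_power2 one_power2)
  have "Re \<epsilon> \<noteq> 1" using e assms(4) by (auto simp: complex_eq_iff)
  moreover have "Re \<epsilon> \<le> 1" using complex_Re_le_cmod[of \<epsilon>] assms(3) by simp
  ultimately have "x * y * Re \<epsilon> < x * y * 1" using assms(1,2) by (intro mult_strict_left_mono) auto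
  moreover have "(cmod (of_real x + of_real y * \<epsilon>))\<^sup>2 = x\<^sup>2 + 2 * (x * y * Re \<epsilon>) + y\<^sup>2 * ((Re \<epsilon>)\<^sup>2 + (Im \<epsilon>)\<^sup>2)"
    unfolding cmod_power2 by (simp add: power2_eq_square algebra_simps)
  ultimately have "(cmod (of_real x + of_real y * \<epsilon>))\<^sup>2 < (x + y)\<^sup>2"
    unfolding e by (simp add: power2_eq_square algebra_simps)
  then show ?thesis using assms(1,2) by (intro power2_less_imp_less[of _ "x + y"]) auto
qed

lemma positive_eigenvector_exists_3:
  fixes a :: "nat \<Rightarrow> nat \<Rightarrow> real"
  assumes pos: "\<And>i j. i < 3 \<Longrightarrow> j < 3 \<Longrightarrow> a i j > 0"
  obtains r x where "\<And>i. i < 3 \<Longrightarrow> x i > 0" "\<And>i. i < 3 \<Longrightarrow> (\<Sum>j<3. a i j * x j) = r * x i"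
proof -
  \<comment> \<open>The type \<open>3\<close> is enumerated as 1, 2, 3 to match
    \<open>sum_3\<close>; \<open>f\<close> and \<open>g\<close> translate between this and the
    indices 0, 1, 2.\<close>
  define f :: "3 \<Rightarrow> nat" where "f k = (if k = 1 then 0 else if k = 2 then 1 else 2)" for k
  define g :: "nat \<Rightarrow> 3" where "g k = (if k = 0 then 1 else if k = 1 then 2 else 3)" for k
  have fg: "f (g k) = k" if "k < 3" for k
    using that unfolding less_3_cases by (auto simp: f_def g_def)
  have "f k < 3" for k by (simp add: f_def)
  then obtain r y where y: "\<And>k. y k > 0" "\<And>k. (\<Sum>l\<in>UNIV. a (f k) (f l) * y l) = r * y k"
    using positive_eigenvector_exists[of "\<lambda>k l. a (f k) (f l)"] pos by metis
  show ?thesis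
  proof
    show "y (g i) > 0" for i by (rule y)
    fix i :: nat assume i: "i < 3"
    have "(\<Sum>l\<in>UNIV. a i (f l) * y l) = (\<Sum>j<3. a i j * y (g j))"
      unfolding sum_3 sum_lessThan_3 by (simp add: f_def g_def)
    then show "(\<Sum>j<3. a i j * y (g j)) = r * y (g i)"
      using y(2)[of "g i"] fg[OF i] by simp
  qed
qed

text \<open>Multiply the two equations and drop the positive terms that contain \<open>u\<close> or
  \<open>v\<close>. In the application they are two rows of an eigenvector equation, and
  \<open>u\<close>, \<open>v\<close> are the contributions of the third coordinate.\<close>

lemma pair_minor_pos:
  fixes x y :: real
  assumes "x > 0" "y > 0" "u > 0" "v > 0" "(r - a) * x = b * y + u" "(r - d) * y = c * x + v" "b > 0" "c > 0"
  shows "b * c < (r - a) * (r - d)"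
proof -
  have "(b * c) * (x * y) < (b * y + u) * (c * x + v)"
    using assms by (simp add: algebra_simps add_pos_pos)
  also have "\<dots> = ((r - a) * (r - d)) * (x * y)"
    unfolding assms(5,6)[symmetric] by (simp add: mult_ac)
  finally show ?thesis using assms(1,2) by simp
qed

text \<open>The positive eigenvector puts all other eigenvalues below \<open>r\<close> in modulus
  and makes the derivative of the characteristic polynomial positive at \<open>r\<close>. Simplicity
  and maximality are then exactly the input of \<open>cardano_largest_root\<close>.\<close>

lemma principal_eigenvalue_3:
  fixes a :: "nat \<Rightarrow> nat \<Rightarrow> real"
  assumes A: "A \<in> carrier_mat 3 3"
    and Aa: "\<And>i j. i < 3 \<Longrightarrow> j < 3 \<Longrightarrow> A $$ (i, j) = complex_of_real (a i j)"
    and pos: "\<And>i j. i < 3 \<Longrightarrow> j < 3 \<Longrightarrow> a i j > 0"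
    and x: "\<And>i. i < 3 \<Longrightarrow> x i > 0" and ax: "\<And>i. i < 3 \<Longrightarrow> (\<Sum>j<3. a i j * x j) = r * x i"
  shows "principal_eigenvalue A r"
    and "cardano (Re (coeff (char_poly A) 2)) (Re (coeff (char_poly A) 1)) (Re (coeff (char_poly A) 0)) = of_real r"
proof -
  define R where "R = mat 3 3 (\<lambda>(i, j). a i j)"
  have R: "R \<in> carrier_mat 3 3" by (simp add: R_def)
  have AR: "A = map_mat complex_of_real R"
    using A Aa by (intro eq_matI) (auto simp: R_def)
  define m where "m i j = a i i * a j j - a i j * a j i" for i j
  define B C D where "B = - (a 0 0 + a 1 1 + a 2 2)" and "C = m 0 1 + m 0 2 + m 1 2" and "D = - det R"
  have cpR: "char_poly R = [:D, C, B, 1:]"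
    unfolding char_poly_3[OF R] by (simp add: B_def C_def D_def m_def R_def)
  have cpA: "char_poly A = map_poly complex_of_real [:D, C, B, 1:]"
    unfolding AR cpR[symmetric] by (rule of_real_hom.char_poly_hom[OF R])
  have poly_cpA: "poly (char_poly A) (of_real z) = of_real (z ^ 3 + B * z\<^sup>2 + C * z + D)" for z
    unfolding cpA by (simp add: algebra_simps power2_eq_square power3_eq_cube)
  have ev: "eigenvalue A (of_real r)"
  proof -
    let ?v = "vec 3 (\<lambda>i. complex_of_real (x i))"
    have "A *\<^sub>v ?v = of_real r \<cdot>\<^sub>v ?v"
    proof (rule eq_vecI)
      fix i assume "i < dim_vec (of_real r \<cdot>\<^sub>v ?v)"
      then have i: "i < 3" by simp
      then have "vec_index (A *\<^sub>v ?v) i = (\<Sum>j<3. complex_of_real (a i j * x j))"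
        using A Aa by (simp add: scalar_prod_def atLeast0LessThan)
      also have "\<dots> = vec_index (of_real r \<cdot>\<^sub>v ?v) i"
        using i arg_cong[OF ax[OF i], of complex_of_real] by simp
      finally show "vec_index (A *\<^sub>v ?v) i = vec_index (of_real r \<cdot>\<^sub>v ?v) i" .
    qed (use A in auto)
    moreover have "?v \<noteq> 0\<^sub>v 3"
    proof
      assume "?v = 0\<^sub>v 3"
      then have "vec_index ?v 0 = vec_index (0\<^sub>v 3) 0" by simp
      then show False using x[of 0] by simp
    qed
    ultimately have "eigenvector A ?v (of_real r)"
      using A unfolding eigenvector_def by auto
    then show ?thesis unfolding eigenvalue_def by blast
  qed
  have root: "r ^ 3 + B * r\<^sup>2 + C * r + D = 0"
    using ev unfolding eigenvalue_root_char_poly[OF A] poly_cpA of_real_eq_0_iff .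
  have minor: "0 < (r - a i i) * (r - a j j) - a i j * a j i"
    if "i < 3" "j < 3" "k < 3" "{i, j, k} = {0, 1, 2}" "i \<noteq> j" "j \<noteq> k" "i \<noteq> k" for i j k
  proof -
    have s: "(\<Sum>l<3. f l) = f i + f j + f k" for f :: "nat \<Rightarrow> real"
    proof -
      have "{..<3} = {i, j, k}" using that(4) by auto
      then show ?thesis using that(5-7) by (simp only: add.assoc) simp
    qed
    have "(r - a i i) * x i = a i j * x j + a i k * x k" "(r - a j j) * x j = a j i * x i + a j k * x k"
      using ax[OF that(1)] ax[OF that(2)] unfolding s by (simp_all add: algebra_simps)
    then have "a i j * a j i < (r - a i i) * (r - a j j)"
      using that x pos by (intro pair_minor_pos[of "x i" "x j" "a i k * x k" "a j k * x k"]) auto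
    then show ?thesis by simp
  qed
  \<comment> \<open>The derivative of the characteristic polynomial at \<open>r\<close> is the sum
    of the principal minors of order two of \<open>r\<close> times the identity minus the
    matrix.\<close>
  have "3 * r\<^sup>2 + 2 * B * r + C =
      ((r - a 0 0) * (r - a 1 1) - a 0 1 * a 1 0) + ((r - a 0 0) * (r - a 2 2) - a 0 2 * a 2 0)
      + ((r - a 1 1) * (r - a 2 2) - a 1 2 * a 2 1)"
    by (simp add: B_def C_def m_def algebra_simps power2_eq_square)
  also have "\<dots> > 0"
    using minor[of 0 1 2] minor[of 0 2 1] minor[of 1 2 0] by (simp add: insert_commute)
  finally have simple: "3 * r\<^sup>2 + 2 * B * r + C \<noteq> 0" by simp
  have others: "cmod z < r" if "eigenvalue A z" "z \<noteq> of_real r" for z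
    by (rule nonprincipal_eigenvalue_less[OF A that x pos Aa ax])
  have "poly (pderiv (char_poly A)) (of_real r) = of_real (3 * r\<^sup>2 + 2 * B * r + C)"
    unfolding cpA by (simp add: pderiv_pCons algebra_simps power2_eq_square)
  then have "poly (pderiv (char_poly A)) (of_real r) \<noteq> 0"
    using simple by (simp only: of_real_eq_0_iff not_False_eq_True)
  then have "Polynomial.order (of_real r) (char_poly A) = 1"
    using ev unfolding eigenvalue_root_char_poly[OF A] by (intro order_eq_1I)
  then show "principal_eigenvalue A r"
    unfolding principal_eigenvalue_def using ev others by auto
  have largest: "z \<le> r" if "z ^ 3 + B * z\<^sup>2 + C * z + D = 0" for z
  proof (cases "z = r")
    case False
    have "eigenvalue A (of_real z)"
      using that unfolding eigenvalue_root_char_poly[OF A] poly_cpA of_real_eq_0_iff .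
    then have "\<bar>z\<bar> < r" using others[of "of_real z"] False by simp
    then show ?thesis by simp
  qed simp
  have "coeff (char_poly A) 2 = of_real B" "coeff (char_poly A) 1 = of_real C" "coeff (char_poly A) 0 = of_real D"
    unfolding cpA by (simp_all add: numeral_2_eq_2)
  then show "cardano (Re (coeff (char_poly A) 2)) (Re (coeff (char_poly A) 1)) (Re (coeff (char_poly A) 0)) = of_real r"
    using cardano_largest_root[OF root simple largest] by simp
qed

section \<open>The three blocks and their eigenvalues\<close>

lemma E_cube_roots:
  obtains \<omega> where "E = {1, \<omega>, \<omega>\<^sup>2}" "\<omega> ^ 3 = 1" "1 + \<omega> + \<omega>\<^sup>2 = 0"
    "cmod \<omega> = 1" "\<omega> \<noteq> 1" "\<omega>\<^sup>2 \<noteq> 1" "\<omega> \<noteq> \<omega>\<^sup>2" "cnj \<omega> = \<omega>\<^sup>2"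
proof
  define \<omega> where "\<omega> = exp (2 * of_real pi * \<i> / 3)"
  have "\<omega>\<^sup>2 = exp (4 * of_real pi * \<i> / 3)"
    unfolding \<omega>_def by (subst exp_of_nat_mult[symmetric]) (simp add: mult.assoc)
  then show "E = {1, \<omega>, \<omega>\<^sup>2}" by (simp add: E_def \<omega>_def)
  have "\<omega> ^ 3 = exp (2 * of_real pi * \<i>)"
    unfolding \<omega>_def exp_of_nat_mult[symmetric] by (rule arg_cong[of _ _ exp]) simp
  then show \<omega>3: "\<omega> ^ 3 = 1" by (simp only: exp_two_pi_i)
  have "Re \<omega> = cos (2 * pi / 3)" by (simp add: \<omega>_def Re_exp)
  then have Re: "Re \<omega> = - 1 / 2" by (simp add: cos_120)
  show n1: "\<omega> \<noteq> 1" using Re by auto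
  have "(\<omega> - 1) * (1 + \<omega> + \<omega>\<^sup>2) = 0"
    using \<omega>3 by (simp add: algebra_simps power2_eq_square power3_eq_cube)
  then show "1 + \<omega> + \<omega>\<^sup>2 = 0" using n1 by simp
  show "\<omega>\<^sup>2 \<noteq> 1"
  proof
    assume "\<omega>\<^sup>2 = 1"
    then have "\<omega> ^ 3 = \<omega>" by (simp add: power2_eq_square power3_eq_cube)
    then show False using \<omega>3 n1 by simp
  qed
  have n0: "\<omega> \<noteq> 0" by (simp add: \<omega>_def)
  show "\<omega> \<noteq> \<omega>\<^sup>2" using n0 n1 by (simp add: power2_eq_square)
  show norm: "cmod \<omega> = 1" by (simp add: \<omega>_def)
  have "\<omega> * cnj \<omega> = \<omega> * \<omega>\<^sup>2"
    using norm \<omega>3 complex_norm_square[of \<omega>] by (simp add: power2_eq_square power3_eq_cube mult.assoc)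
  then show "cnj \<omega> = \<omega>\<^sup>2" using n0 by simp
qed

text \<open>Compare the multisets of roots, so that multiple roots are matched correctly; equal
  image multisets differ by a permutation of the index set.\<close>

lemma prod_linear_factors_eq_permutes:
  fixes f g :: "'a \<Rightarrow> 'b :: idom"
  assumes S: "finite S" and eq: "(\<Prod>k\<in>S. [:- f k, 1:]) = (\<Prod>k\<in>S. [:- g k, 1:])"
  obtains \<pi> where "\<pi> permutes S" "\<forall>k\<in>S. f k = g (\<pi> k)"
proof -
  have "proots (\<Prod>k\<in>S. [:- h k, 1:]) = image_mset h (mset_set S)" for h :: "'a \<Rightarrow> 'b"
    using S
  proof (induction S)
    case (insert x S)
    have "(\<Prod>k\<in>S. [:- h k, 1:]) \<noteq> 0" using insert.hyps by simp
    then show ?case using insert by (simp add: proots_mult del: mult_pCons_left)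
  qed simp
  then have "image_mset f (mset_set S) = image_mset g (mset_set S)" using eq by metis
  then show ?thesis using image_mset_eq_implies_permutes[OF S] that by metis
qed

lemma char_poly_Theta_eps_cnj:
  "char_poly (Theta_eps J T (cnj \<epsilon>)) = map_poly cnj (char_poly (Theta_eps J T \<epsilon>))"
proof -
  interpret cnj: comm_ring_hom cnj by unfold_locales auto
  have "Theta_eps J T (cnj \<epsilon>) = map_mat cnj (Theta_eps J T \<epsilon>)"
  proof (rule eq_matI)
    fix i j assume "i < dim_row (map_mat cnj (Theta_eps J T \<epsilon>))" "j < dim_col (map_mat cnj (Theta_eps J T \<epsilon>))"
    then show "Theta_eps J T (cnj \<epsilon>) $$ (i, j) = map_mat cnj (Theta_eps J T \<epsilon>) $$ (i, j)"
      by (simp add: Theta_eps_index)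
  qed simp_all
  then show ?thesis by (simp add: cnj.char_poly_hom[OF Theta_eps_carrier])
qed

lemma map_poly_cnj_prod_linear_factors:
  "map_poly cnj (\<Prod>k\<in>S. [:- f k, 1:]) = (\<Prod>k\<in>S. [:- cnj (f k), 1:])"
proof -
  interpret cnj: comm_ring_hom cnj by unfold_locales auto
  interpret cnj_poly: map_poly_comm_ring_hom cnj by unfold_locales
  show ?thesis by (simp add: cnj_poly.hom_prod)
qed

lemma char_poly_Theta:
  assumes "\<omega> ^ 3 = 1" "1 + \<omega> + \<omega>\<^sup>2 = 0"
  shows "char_poly (map_mat complex_of_real (Theta J T)) =
    char_poly (Theta_eps J T 1) * (char_poly (Theta_eps J T \<omega>) * char_poly (Theta_eps J T (\<omega>\<^sup>2)))"
  using char_poly_similar[OF Theta_similar_block_diag[OF assms]]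
  by (simp add: char_poly_block_diag[OF Theta_eps_carrier Theta_eps_carrier Theta_eps_carrier])

text \<open>The block for 1 contributes \<open>r\<close> as a simple root. The blocks for the other
  two characters are strictly dominated by it entrywise, so they do not have the root
  \<open>r\<close> and cannot raise its multiplicity in the product.\<close>

lemma principal_eigenvalue_Theta:
  obtains r where "principal_eigenvalue (Theta_eps J T 1) r"
    "principal_eigenvalue (map_mat complex_of_real (Theta J T)) r"
    "cardano (Re (coeff (char_poly (Theta_eps J T 1)) 2)) (Re (coeff (char_poly (Theta_eps J T 1)) 1))
      (Re (coeff (char_poly (Theta_eps J T 1)) 0)) = of_real r"
proof -
  define \<theta> where "\<theta> s s' t = Theta J T $$ (s, (t + s') mod 3 + 3 * t)" for s s' t
  define a where "a s s' = (\<Sum>t<3. \<theta> s s' t)" for s s'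
  have \<theta>pos: "\<theta> s s' t > 0" if "s < 3" "t < 3" for s s' t
  proof -
    have "(t + s') mod 3 + 3 * t < 9" using that mod_less_divisor[of 3 "t + s'"] by linarith
    then show ?thesis using that unfolding \<theta>_def by (simp add: Theta_index)
  qed
  have apos: "a s s' > 0" if "s < 3" for s s'
    unfolding a_def sum_lessThan_3 using \<theta>pos[OF that] by (intro add_pos_pos) auto
  obtain r x where x: "\<And>i. i < 3 \<Longrightarrow> x i > 0" and ax: "\<And>i. i < 3 \<Longrightarrow> (\<Sum>j<3. a i j * x j) = r * x i"
    using positive_eigenvector_exists_3[of a] apos by metis
  have idx: "Theta_eps J T \<epsilon> $$ (s, s') = (\<Sum>t<3. complex_of_real (\<theta> s s' t) * \<epsilon> ^ t)"
    if "s < 3" "s' < 3" for \<epsilon> s s'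
    unfolding \<theta>_def by (rule Theta_eps_index[OF that])
  have idx1: "Theta_eps J T 1 $$ (s, s') = complex_of_real (a s s')" if "s < 3" "s' < 3" for s s'
    by (simp add: idx[OF that] a_def)
  note principal = principal_eigenvalue_3[OF Theta_eps_carrier idx1 apos x ax]
  have less: "cmod z < r" if "eigenvalue (Theta_eps J T \<epsilon>) z" "cmod \<epsilon> = 1" "\<epsilon> \<noteq> 1" for \<epsilon> z
  proof (rule dominated_eigenvalue_less[OF Theta_eps_carrier that(1) x _ ax])
    fix i j :: nat assume ij: "i < 3" "j < 3"
    \<comment> \<open>Strictness comes from the first two terms alone; the plain triangle inequality
      handles the third.\<close>
    have "cmod (Theta_eps J T \<epsilon> $$ (i, j)) \<le>
        cmod (of_real (\<theta> i j 0) + of_real (\<theta> i j 1) * \<epsilon>) + cmod (of_real (\<theta> i j 2) * \<epsilon>\<^sup>2)"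
      unfolding idx[OF ij] sum_lessThan_3 by (simp add: norm_triangle_ineq)
    also have "cmod (of_real (\<theta> i j 2) * \<epsilon>\<^sup>2) = \<theta> i j 2"
      using \<theta>pos[OF ij(1), of 2 j] that(2) by (simp add: norm_mult norm_power)
    also have "cmod (of_real (\<theta> i j 0) + of_real (\<theta> i j 1) * \<epsilon>) < \<theta> i j 0 + \<theta> i j 1"
      using \<theta>pos[OF ij(1)] that by (intro cmod_add_unit_less) auto
    finally show "cmod (Theta_eps J T \<epsilon> $$ (i, j)) < a i j"
      by (simp add: a_def sum_lessThan_3)
  qed
  obtain \<omega> where \<omega>: "\<omega> ^ 3 = 1" "1 + \<omega> + \<omega>\<^sup>2 = 0" "cmod \<omega> = 1" "\<omega> \<noteq> 1" "\<omega>\<^sup>2 \<noteq> 1"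
    by (rule E_cube_roots)
  let ?\<Theta> = "map_mat complex_of_real (Theta J T)"
  let ?p = "\<lambda>\<epsilon>. char_poly (Theta_eps J T \<epsilon>)"
  have \<Theta>: "?\<Theta> \<in> carrier_mat 9 9" by simp
  have cp: "char_poly ?\<Theta> = ?p 1 * (?p \<omega> * ?p (\<omega>\<^sup>2))"
    by (rule char_poly_Theta[OF \<omega>(1,2)])
  have ev: "eigenvalue ?\<Theta> z \<longleftrightarrow> eigenvalue (Theta_eps J T 1) z \<or> eigenvalue (Theta_eps J T \<omega>) z
      \<or> eigenvalue (Theta_eps J T (\<omega>\<^sup>2)) z" for z
    by (simp add: eigenvalue_root_char_poly[OF \<Theta>] eigenvalue_root_char_poly[OF Theta_eps_carrier] cp)
  have less\<omega>: "cmod z < r" if "eigenvalue (Theta_eps J T \<omega>) z \<or> eigenvalue (Theta_eps J T (\<omega>\<^sup>2)) z" for z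
    using that less \<omega> by (auto simp: norm_power)
  have nz: "?p \<epsilon> \<noteq> 0" for \<epsilon>
    using degree_monic_char_poly[OF Theta_eps_carrier[of J T \<epsilon>]] by auto
  have r0: "0 < r"
  proof -
    have "0 < r * x 0" using ax[of 0] apos x by (simp add: sum_lessThan_3 add_pos_pos flip: ax)
    then show ?thesis using x[of 0] by (simp add: zero_less_mult_iff)
  qed
  have "Polynomial.order (of_real r) (?p \<epsilon>) = 0" if "\<epsilon> = \<omega> \<or> \<epsilon> = \<omega>\<^sup>2" for \<epsilon>
  proof (rule order_0I)
    show "poly (?p \<epsilon>) (of_real r) \<noteq> 0"
      using less\<omega>[of "of_real r"] that r0
      unfolding eigenvalue_root_char_poly[OF Theta_eps_carrier] by auto
  qed
  then have "Polynomial.order (of_real r) (char_poly ?\<Theta>) = 1"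
    using principal(1) nz unfolding cp principal_eigenvalue_def by (simp add: order_mult)
  then have "principal_eigenvalue ?\<Theta> r"
    using principal(1) less\<omega> unfolding principal_eigenvalue_def ev by blast
  then show ?thesis using that principal by blast
qed

theorem theorem2p1:
  fixes J :: "nat \<Rightarrow> nat \<Rightarrow> nat \<Rightarrow> real" and T :: real and L :: nat
    and lam :: "complex \<Rightarrow> nat \<Rightarrow> complex"
  assumes "T > 0" and "L \<ge> 1"
    and "eigenvalue_numbering J T lam"
  shows "complex_of_real (partition_function J T L) = (\<Sum>\<epsilon>\<in>E. \<Sum>k\<in>{1..3}. lam \<epsilon> k ^ L) \<and>
    (\<exists>r::real.
       principal_eigenvalue (Theta_eps J T 1) r \<and>
       principal_eigenvalue (map_mat complex_of_real (Theta J T)) r \<and>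
       (let cp = char_poly (Theta_eps J T 1)
        in complex_of_real r = cardano (Re (coeff cp 2)) (Re (coeff cp 1)) (Re (coeff cp 0)))) \<and>
    (\<forall>\<epsilon>\<in>E. \<exists>\<pi>. \<pi> permutes {1..3} \<and> (\<forall>k\<in>{1..3}. cnj (lam \<epsilon> k) = lam (cnj \<epsilon>) (\<pi> k))) \<and>
    (\<exists>mu. eigenvalue_numbering J T mu \<and>
       (\<forall>\<epsilon>\<in>E. \<forall>k\<in>{1..3}. \<epsilon> \<noteq> 1 \<or> mu \<epsilon> k \<in> \<real> \<longrightarrow> cnj (mu \<epsilon> k) = mu (cnj \<epsilon>) k))"
proof (intro conjI)
  obtain \<omega> where E: "E = {1, \<omega>, \<omega>\<^sup>2}" and \<omega>: "\<omega> ^ 3 = 1" "1 + \<omega> + \<omega>\<^sup>2 = 0"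
    and ne: "\<omega> \<noteq> 1" "\<omega>\<^sup>2 \<noteq> 1" "\<omega> \<noteq> \<omega>\<^sup>2" and cnj\<omega>: "cnj \<omega> = \<omega>\<^sup>2"
    by (rule E_cube_roots)
  have cnj\<omega>2: "cnj (\<omega>\<^sup>2) = \<omega>" by (metis cnj\<omega> complex_cnj_cnj)
  have cnjE: "cnj \<epsilon> \<in> E" if "\<epsilon> \<in> E" for \<epsilon>
    using that cnj\<omega> cnj\<omega>2 unfolding E by auto
  have cp: "char_poly (Theta_eps J T \<epsilon>) = (\<Prod>k\<in>{1..3}. [:- lam \<epsilon> k, 1:])" if "\<epsilon> \<in> E" for \<epsilon>
    using assms(3) that unfolding eigenvalue_numbering_def by blast
  have cp_cnj: "char_poly (Theta_eps J T (cnj \<epsilon>)) = (\<Prod>k\<in>{1..3}. [:- cnj (lam \<epsilon> k), 1:])" if "\<epsilon> \<in> E" for \<epsilon>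
    unfolding char_poly_Theta_eps_cnj cp[OF that] by (rule map_poly_cnj_prod_linear_factors)

  define es where "es = concat (map (\<lambda>\<epsilon>. map (lam \<epsilon>) [1, 2, 3]) [1, \<omega>, \<omega>\<^sup>2])"
  have set3: "{Suc 0..3} = {1, 2, 3::nat}" by auto
  let ?\<Theta> = "map_mat complex_of_real (Theta J T)"
  have \<Theta>: "?\<Theta> \<in> carrier_mat 9 9" by simp
  have "char_poly ?\<Theta> = char_poly (Theta_eps J T 1) * (char_poly (Theta_eps J T \<omega>) * char_poly (Theta_eps J T (\<omega>\<^sup>2)))"
    by (rule char_poly_Theta[OF \<omega>])
  also have "\<dots> = (\<Prod>e\<leftarrow>es. [:- e, 1:])"
    by (simp add: cp E set3 es_def mult_ac del: mult_pCons_left mult_pCons_right)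
  finally have "(\<Sum>i<9. (?\<Theta> ^\<^sub>m L) $$ (i, i)) = (\<Sum>e\<leftarrow>es. e ^ L)"
    by (rule sum_diag_pow_eq_sum_eigenvalues[OF \<Theta>])
  moreover have "?\<Theta> ^\<^sub>m L = map_mat complex_of_real (Theta J T ^\<^sub>m L)"
    by (rule of_real_hom.mat_hom_pow[OF Theta_carrier, symmetric])
  ultimately have "complex_of_real (partition_function J T L) = (\<Sum>e\<leftarrow>es. e ^ L)"
    using pow_carrier_mat[OF Theta_carrier[of J T], of L]
    by (simp add: partition_function_eq_sum_diag_pow[OF assms(2)])
  also have "\<dots> = (\<Sum>\<epsilon>\<in>E. \<Sum>k\<in>{1..3}. lam \<epsilon> k ^ L)"
    \<comment> \<open>Distinctness of the three roots is what makes the sum over the set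
      \<open>E\<close> have three summands.\<close>
    using ne ne[symmetric] by (simp add: E set3 es_def add_ac)
  finally show "complex_of_real (partition_function J T L) = (\<Sum>\<epsilon>\<in>E. \<Sum>k\<in>{1..3}. lam \<epsilon> k ^ L)" .

  show "\<exists>r::real. principal_eigenvalue (Theta_eps J T 1) r \<and>
       principal_eigenvalue (map_mat complex_of_real (Theta J T)) r \<and>
       (let cp = char_poly (Theta_eps J T 1)
        in complex_of_real r = cardano (Re (coeff cp 2)) (Re (coeff cp 1)) (Re (coeff cp 0)))"
    using principal_eigenvalue_Theta[of J T] unfolding Let_def by metis

  \<comment> \<open>The numberings for \<open>\<epsilon>\<close> and \<open>cnj \<epsilon>\<close>
    are chosen independently, hence the permutation; conjugating one factorisation gives a second
    factorisation of the same polynomial.\<close>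
  show "\<forall>\<epsilon>\<in>E. \<exists>\<pi>. \<pi> permutes {1..3} \<and> (\<forall>k\<in>{1..3}. cnj (lam \<epsilon> k) = lam (cnj \<epsilon>) (\<pi> k))"
  proof
    fix \<epsilon> assume \<epsilon>: "\<epsilon> \<in> E"
    show "\<exists>\<pi>. \<pi> permutes {1..3} \<and> (\<forall>k\<in>{1..3}. cnj (lam \<epsilon> k) = lam (cnj \<epsilon>) (\<pi> k))"
      by (rule prod_linear_factors_eq_permutes[OF _ trans[OF cp_cnj[OF \<epsilon>, symmetric] cp[OF cnjE[OF \<epsilon>]]]]) auto
  qed

  \<comment> \<open>The numbering is kept for 1 and \<open>\<omega>\<close> and copied by
    conjugation to \<open>\<omega>\<^sup>2\<close>. For 1, which is its own conjugate, conjugation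
    fixes the real eigenvalues index by index.\<close>
  define mu where "mu \<epsilon> = (if \<epsilon> = \<omega>\<^sup>2 then \<lambda>k. cnj (lam \<omega> k) else lam \<epsilon>)" for \<epsilon>
  have "eigenvalue_numbering J T mu"
    using cp cp_cnj[of \<omega>] cnj\<omega> unfolding eigenvalue_numbering_def mu_def by (auto simp: E)
  moreover have "cnj (mu \<epsilon> k) = mu (cnj \<epsilon>) k" if "\<epsilon> \<in> E" "\<epsilon> \<noteq> 1 \<or> mu \<epsilon> k \<in> \<real>" for \<epsilon> k
    using that ne cnj\<omega> cnj\<omega>2 unfolding E by (auto simp: mu_def Reals_cnj_iff)
  ultimately show "\<exists>mu. eigenvalue_numbering J T mu \<and>
       (\<forall>\<epsilon>\<in>E. \<forall>k\<in>{1..3}. \<epsilon> \<noteq> 1 \<or> mu \<epsilon> k \<in> \<real> \<longrightarrow> cnj (mu \<epsilon> k) = mu (cnj \<epsilon>) k)"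
    by blast
qed

end
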